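(* Let $\mathbf t=(t_0,u_0,t_1,u_1)\in\mathbb C^4$ be generic (in the sense specified in the context). The set of non-symmetric Wilson polynomials $\{p_m: m\in\mathbb Z_{\ge0}\}$ is an orthogonal basis for $\mathcal A=\mathbb C[x]$ with respect to the bilinear form $\langle\cdot,\cdot\rangle_{\mathbf t}$.
   Context: $\mathbb N=\{1,2,\dots\}$. Put $(a,b,c,d)=(t_1+u_1,\,t_1-u_1,\,t_0+u_0+\frac12,\,t_0-u_0+\frac12)$. Generic means: $t_0,t_1\ne0$; $t_0+t_1\notin-\frac12\mathbb N$; $a,b,c,d\notin-\frac12\mathbb Z_{\ge0}$; no sum of two of $a,b,c,d$ (at distinct positions) lies in $\mathbb Z$. Operators on $\mathcal A$: $$(T_0f)(x)=t_0f(x)+\frac{(c-x)(d-x)}{1-2x}\big(f(1-x)-f(x)\big),\quad (T_1f)(x)=t_1f(x)+\frac{(a+x)(b+x)}{2x}\big(f(-x)-f(x)\big),$$ $Y=T_0+T_1$. With $\gamma_{2n}=t_0+t_1+n$ ($n\ge0$), $\gamma_{2n-1}=-(t_0+t_1+n)$ ($n\ge1$), the non-symmetric Wilson polynomial $p_m$ is the unique monic polynomial of degree $m$ with $Yp_m=\gamma_mp_m$. Weight function, with $\Gamma(\alpha\pm\beta)=\Gamma(\alpha+\beta)\Gamma(\alpha-\beta)$: $$\Delta(x)=\frac{\Gamma(a+x)\Gamma(a+1-x)\Gamma(b+x)\Gamma(b+1-x)\Gamma(c\pm x)\Gamma(d\pm x)}{\Gamma(2x)\Gamma(1-2x)}.$$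 $\mathcal C$ is a contour running along the imaginary axis from $-i\infty$ to $i\infty$, indented so that it separates the sequences $a+n,b+n,c+n,d+n$ ($n\in\mathbb Z_{\ge0}$) from the sequences $-(a+n),-(b+n),-(c+n),-(d+n)$ ($n\in\mathbb Z_{\ge0}$), and with $\mathcal C=-\mathcal C$ as a set. The bilinear form is $\langle f,g\rangle_{\mathbf t}=\frac1{2\pi i}\int_{\mathcal C}f(x)g(x)\Delta(x)\,dx$ for $f,g\in\mathcal A$. *)

theory Defs
  imports "HOL-Complex_Analysis.Complex_Analysis" "HOL-Computational_Algebra.Polynomial"
begin

definition par_a :: "complex \<Rightarrow> complex \<Rightarrow> complex" where "par_a t1 u1 = t1 + u1"
definition par_b :: "complex \<Rightarrow> complex \<Rightarrow> complex" where "par_b t1 u1 = t1 - u1"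
definition par_c :: "complex \<Rightarrow> complex \<Rightarrow> complex" where "par_c t0 u0 = t0 + u0 + 1/2"
definition par_d :: "complex \<Rightarrow> complex \<Rightarrow> complex" where "par_d t0 u0 = t0 - u0 + 1/2"

definition generic :: "complex \<Rightarrow> complex \<Rightarrow> complex \<Rightarrow> complex \<Rightarrow> bool" where
  "generic t0 u0 t1 u1 \<longleftrightarrow>
    (let a = par_a t1 u1; b = par_b t1 u1; c = par_c t0 u0; d = par_d t0 u0 in
      t0 \<noteq> 0 \<and> t1 \<noteq> 0 \<and>
      (\<forall>n::nat. n \<ge> 1 \<longrightarrow> t0 + t1 \<noteq> - (of_nat n / 2)) \<and>
      (\<forall>e\<in>{a, b, c, d}. \<forall>n::nat. e \<noteq> - (of_nat n / 2)) \<and>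
      a + b \<notin> \<int> \<and> a + c \<notin> \<int> \<and> a + d \<notin> \<int> \<and> b + c \<notin> \<int> \<and> b + d \<notin> \<int> \<and> c + d \<notin> \<int>)"

text \<open>
  The difference quotients are polynomial divisions without remainder; the lemmas
  \<open>poly_T0\<close> and \<open>poly_T1\<close> below give the pointwise formulas.
\<close>

definition T0 :: "complex \<Rightarrow> complex \<Rightarrow> complex poly \<Rightarrow> complex poly" where
  "T0 t0 u0 f = smult t0 f +
     [:par_c t0 u0, -1:] * [:par_d t0 u0, -1:] * ((pcompose f [:1, -1:] - f) div [:1, -2:])"

definition T1 :: "complex \<Rightarrow> complex \<Rightarrow> complex poly \<Rightarrow> complex poly" where
  "T1 t1 u1 f = smult t1 f +
     [:par_a t1 u1, 1:] * [:par_b t1 u1, 1:] * ((pcompose f [:0, -1:] - f) div [:0, 2:])"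

lemma poly_T0:
  assumes "x \<noteq> 1/2"
  shows "poly (T0 t0 u0 f) x = t0 * poly f x +
    (par_c t0 u0 - x) * (par_d t0 u0 - x) / (1 - 2 * x) * (poly f (1 - x) - poly f x)"
proof -
  let ?g = "pcompose f [:1, -1:] - f"
  have "[:-(1/2), 1:] dvd ?g"
    by (simp add: poly_eq_0_iff_dvd[symmetric] poly_pcompose)
  moreover have "[:1, -2:] = smult (-2) [:-(1/2), 1::complex:]" by simp
  ultimately have "[:1, -2:] dvd ?g" by (metis smult_dvd neg_numeral_neq_numeral neg_equal_0_iff_equal zero_neq_numeral)
  then have "?g = (?g div [:1, -2:]) * [:1, -2:]" by (rule dvd_div_mult_self[symmetric])
  then have "poly ?g x = poly (?g div [:1, -2:]) x * poly [:1, -2:] x"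
    by (metis poly_mult)
  moreover have "1 - 2 * x \<noteq> 0" using assms by (auto simp: field_simps)
  ultimately have "poly (?g div [:1, -2:]) x = (poly f (1 - x) - poly f x) / (1 - 2 * x)"
    by (simp add: poly_pcompose field_simps)
  then show ?thesis
    unfolding T0_def poly_add poly_smult poly_mult by simp
qed

lemma poly_T1:
  assumes "x \<noteq> 0"
  shows "poly (T1 t1 u1 f) x = t1 * poly f x +
    (par_a t1 u1 + x) * (par_b t1 u1 + x) / (2 * x) * (poly f (- x) - poly f x)"
proof -
  let ?g = "pcompose f [:0, -1:] - f"
  have "[:-0, 1:] dvd ?g"
    by (simp only: poly_eq_0_iff_dvd[symmetric]) (simp add: poly_pcompose)
  moreover have "[:0, 2:] = smult 2 [:-0, 1::complex:]" by simp
  ultimately have "[:0, 2:] dvd ?g" by (metis smult_dvd zero_neq_numeral)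
  then have "?g = (?g div [:0, 2:]) * [:0, 2:]" by (rule dvd_div_mult_self[symmetric])
  then have "poly ?g x = poly (?g div [:0, 2:]) x * poly [:0, 2:] x"
    by (metis poly_mult)
  then have "poly (?g div [:0, 2:]) x = (poly f (- x) - poly f x) / (2 * x)"
    using assms by (simp add: poly_pcompose field_simps)
  then show ?thesis
    unfolding T1_def poly_add poly_smult poly_mult by simp
qed

definition Y :: "complex \<Rightarrow> complex \<Rightarrow> complex \<Rightarrow> complex \<Rightarrow> complex poly \<Rightarrow> complex poly" where
  "Y t0 u0 t1 u1 f = T0 t0 u0 f + T1 t1 u1 f"

definition eigval :: "complex \<Rightarrow> complex \<Rightarrow> nat \<Rightarrow> complex" where
  "eigval t0 t1 m =
    (if even m then t0 + t1 + of_nat (m div 2) else - (t0 + t1 + of_nat ((m + 1) div 2)))"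

definition wilson_poly :: "complex \<Rightarrow> complex \<Rightarrow> complex \<Rightarrow> complex \<Rightarrow> nat \<Rightarrow> complex poly" where
  "wilson_poly t0 u0 t1 u1 m =
    (THE p. degree p = m \<and> lead_coeff p = 1 \<and> Y t0 u0 t1 u1 p = smult (eigval t0 t1 m) p)"

text \<open>
  Where \<open>2 * x\<close> is an integer, a factor of the denominator is a pole of \<open>Gamma\<close>,
  where \<open>Gamma\<close> is \<open>0\<close> by convention, so the quotient is \<open>0\<close>. This is the right value: for
  \<open>2 * x\<close> not an integer, \<open>1 / (Gamma (2*x) * Gamma (1 - 2*x)) = sin (2*pi*x) / pi\<close>.
\<close>

definition weight :: "complex \<Rightarrow> complex \<Rightarrow> complex \<Rightarrow> complex \<Rightarrow> complex \<Rightarrow> complex" where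
  "weight t0 u0 t1 u1 x =
    (let a = par_a t1 u1; b = par_b t1 u1; c = par_c t0 u0; d = par_d t0 u0 in
      Gamma (a + x) * Gamma (a + 1 - x) * Gamma (b + x) * Gamma (b + 1 - x) *
      (Gamma (c + x) * Gamma (c - x)) * (Gamma (d + x) * Gamma (d - x)) /
      (Gamma (2 * x) * Gamma (1 - 2 * x)))"

text \<open>
  A contour along the imaginary axis with indentations is represented by a real \<open>R > 0\<close> and a path
  \<open>g\<close> from \<open>- \<i> R\<close> to \<open>\<i> R\<close> carrying all the indentations; outside \<open>g\<close> it consists of
  the two half-lines \<open>{\<i> y | \<bar>y\<bar> \<ge> R}\<close>.
\<close>

definition contour_set :: "real \<Rightarrow> (real \<Rightarrow> complex) \<Rightarrow> complex set" where
  "contour_set R g = path_image g \<union> {\<i> * of_real y | y. \<bar>y\<bar> \<ge> R}"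

definition separates :: "complex set \<Rightarrow> complex set \<Rightarrow> complex set \<Rightarrow> bool" where
  "separates C P Q \<longleftrightarrow>
    (\<exists>U V. U \<in> components (- C) \<and> V \<in> components (- C) \<and> U \<noteq> V \<and> P \<subseteq> U \<and> Q \<subseteq> V)"

definition admissible_contour ::
    "complex \<Rightarrow> complex \<Rightarrow> complex \<Rightarrow> complex \<Rightarrow> real \<Rightarrow> (real \<Rightarrow> complex) \<Rightarrow> bool" where
  "admissible_contour t0 u0 t1 u1 R g \<longleftrightarrow>
    (let P = {e + of_nat n | e n. e \<in> {par_a t1 u1, par_b t1 u1, par_c t0 u0, par_d t0 u0}} in
      R > 0 \<and> valid_path g \<and> arc g \<and>
      pathstart g = - \<i> * of_real R \<and> pathfinish g = \<i> * of_real R \<and>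
      path_image g \<inter> {\<i> * of_real y | y. \<bar>y\<bar> > R} = {} \<and>
      uminus ` contour_set R g = contour_set R g \<and>
      separates (contour_set R g) P (uminus ` P))"

definition full_contour_integral ::
    "real \<Rightarrow> (real \<Rightarrow> complex) \<Rightarrow> (complex \<Rightarrow> complex) \<Rightarrow> complex" where
  "full_contour_integral R g F =
    integral {..-R} (\<lambda>y. F (\<i> * of_real y) * \<i>) + contour_integral g F +
    integral {R..} (\<lambda>y. F (\<i> * of_real y) * \<i>)"

definition wilson_form ::
    "complex \<Rightarrow> complex \<Rightarrow> complex \<Rightarrow> complex \<Rightarrow> real \<Rightarrow> (real \<Rightarrow> complex) \<Rightarrow>
     complex poly \<Rightarrow> complex poly \<Rightarrow> complex" where
  "wilson_form t0 u0 t1 u1 R g f h =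
    1 / (2 * of_real pi * \<i>) *
    full_contour_integral R g (\<lambda>x. poly f x * poly h x * weight t0 u0 t1 u1 x)"

lemma vector_space_smult: "vector_space (smult :: complex \<Rightarrow> complex poly \<Rightarrow> complex poly)"
  by unfold_locales (simp_all add: smult_add_left smult_add_right)

end

theory Submission imports Defs begin

text \<open>
  \<open>Y\<close> is triangular on the monomials with pairwise distinct diagonal entries, so its eigenpolynomials
  form a basis, and orthogonality follows once \<open>Y\<close> is symmetric for the form. The difference
  \<open>Yf h - f Yh\<close> times the weight is a sum \<open>G + H\<close> with \<open>G(-x) = -G(x)\<close> (from \<open>T1\<close>) and
  \<open>H(1-x) = -H(x)\<close> (from \<open>T0\<close>). As the contour \<open>C\<close> is symmetric, \<open>G\<close> integrates to 0, and
  the integral of \<open>H\<close> over \<open>C\<close> is minus that over \<open>C + 1\<close>. But each pole of \<open>H\<close> lies to the left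
  of both contours or to the right of both, and \<open>H\<close> decays exponentially in vertical strips, so
  the two integrals agree by Cauchy's theorem and hence vanish.
\<close>

subsection \<open>Eigenpolynomials\<close>

text \<open>The coefficients of the two operators supply exactly what the weight lacks to be
  symmetric. The factor (a+x)(b+x) turns Gamma(a+x) Gamma(b+x) into Gamma(a+1+x) Gamma(b+1+x), so
  that all Gamma factors pair up under x -> -x. The factor (c-x)(d-x) turns Gamma(c-x) Gamma(d-x)
  into Gamma(c+1-x) Gamma(d+1-x), so that they pair up under x -> 1-x. The remaining sin(2 pi x)
  changes sign under both. In the second case the poles are -(e+n) and e+1+n for e among a, b, c, d;
  this +1 is the room that a translation by 1 needs. Eight Gamma factors, each decaying like exp(-pi
  |y|/2) up to powers of |y|, outweigh the growth exp(2 pi |y|) of the sine. Two obstacles shape the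
  contour part. The contour is symmetric only as a set, so its parametrization has to be compared
  with the reflected one by a homotopy. And Cauchy's theorem asks for a closed path, so all
  integrals are taken over truncations at height S, with S tending to infinity at the end.\<close>

definition D0 :: "complex poly \<Rightarrow> complex poly" where
  "D0 f = (pcompose f [:1, -1:] - f) div [:1, -2:]"

definition D1 :: "complex poly \<Rightarrow> complex poly" where
  "D1 f = (pcompose f [:0, -1:] - f) div [:0, 2:]"

lemma T0_D0: "T0 t0 u0 f = smult t0 f + [:par_c t0 u0, -1:] * [:par_d t0 u0, -1:] * D0 f"
  by (simp add: T0_def D0_def)

lemma T1_D1: "T1 t1 u1 f = smult t1 f + [:par_a t1 u1, 1:] * [:par_b t1 u1, 1:] * D1 f"
  by (simp add: T1_def D1_def)

text \<open>The reflection x -> 1 - x fixes 1/2, so the numerator vanishes there and the division is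
  exact. \<open>D0\<close> and \<open>D1\<close> are the divided differences of the two reflections;
  once this identity and \<open>D1_mult\<close> are available, they are handled by cancellation
  instead of \<open>div\<close>.\<close>

lemma D0_mult: "[:1, -2:] * D0 f = pcompose f [:1, -1:] - f"
proof -
  have "[:-(1/2), 1:] dvd pcompose f [:1, -1:] - f"
    by (simp add: poly_eq_0_iff_dvd[symmetric] poly_pcompose)
  moreover have "[:1, -2:] = smult (-2) [:-(1/2), 1::complex:]" by simp
  ultimately have "[:1, -2:] dvd pcompose f [:1, -1:] - f"
    by (metis smult_dvd neg_numeral_neq_numeral neg_equal_0_iff_equal zero_neq_numeral)
  then show ?thesis
    unfolding D0_def by (rule dvd_mult_div_cancel)
qed

lemma D1_mult: "[:0, 2:] * D1 f = pcompose f [:0, -1:] - f"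
proof -
  have "[:-0, 1:] dvd pcompose f [:0, -1:] - f"
    by (simp only: poly_eq_0_iff_dvd[symmetric]) (simp add: poly_pcompose)
  moreover have "[:0, 2:] = smult 2 [:-0, 1::complex:]" by simp
  ultimately have "[:0, 2:] dvd pcompose f [:0, -1:] - f" by (metis smult_dvd zero_neq_numeral)
  then show ?thesis
    unfolding D1_def by (rule dvd_mult_div_cancel)
qed

lemma D0_unique: "[:1, -2:] * q = pcompose f [:1, -1:] - f \<Longrightarrow> D0 f = q"
  unfolding D0_mult[symmetric] by (subst (asm) mult_cancel_left) auto

lemma D1_unique: "[:0, 2:] * q = pcompose f [:0, -1:] - f \<Longrightarrow> D1 f = q"
  unfolding D1_mult[symmetric] by (subst (asm) mult_cancel_left) auto

lemma D0_add: "D0 (f + g) = D0 f + D0 g"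
  by (rule D0_unique) (simp only: distrib_left D0_mult pcompose_add, simp)

lemma D1_add: "D1 (f + g) = D1 f + D1 g"
  by (rule D1_unique) (simp only: distrib_left D1_mult pcompose_add, simp)

lemma D0_smult: "D0 (smult c f) = smult c (D0 f)"
  by (rule D0_unique) (simp only: mult_smult_right D0_mult pcompose_smult smult_diff_right)

lemma D1_smult: "D1 (smult c f) = smult c (D1 f)"
  by (rule D1_unique) (simp only: mult_smult_right D1_mult pcompose_smult smult_diff_right)

lemma Y_add: "Y t0 u0 t1 u1 (f + g) = Y t0 u0 t1 u1 f + Y t0 u0 t1 u1 g"
  unfolding Y_def T0_D0 T1_D1 D0_add D1_add smult_add_right distrib_left
  by (simp only: ac_simps)

lemma Y_smult: "Y t0 u0 t1 u1 (smult c f) = smult c (Y t0 u0 t1 u1 f)"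
  by (simp only: Y_def T0_D0 T1_D1 D0_smult D1_smult smult_add_right mult_smult_right
      smult_smult mult.commute[of c])

text \<open>Product rule of a divided difference: \<open>D0\<close> (x f) = f + (1 - x)
  \<open>D0\<close> f, where the factor in front of \<open>D0\<close> f is the reflected x.\<close>

lemma D0_monom_Suc: "D0 (monom 1 (Suc m)) = monom 1 m + [:1, -1:] * D0 (monom 1 m)"
proof (rule D0_unique)
  have *: "pcompose (monom 1 (Suc m)) [:1, -1:] = [:1, -1:] * pcompose (monom 1 m) [:1, -1::complex:]"
    by (simp add: monom_Suc pcompose_pCons)
  have **: "monom 1 (Suc m) = [:0,1:] * (monom 1 m :: complex poly)"
    by (simp add: monom_Suc)
  have "[:1, - 2:] * (monom 1 m + [:1, - 1:] * D0 (monom 1 m)) =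
     [:1, -2:] * monom 1 m + [:1, -1:] * ([:1, -2:] * D0 (monom 1 m))"
    by (simp only: algebra_simps)
  also have "\<dots> = ([:1,-2:] - [:1,-1:]) * monom 1 m + [:1,-1:] * pcompose (monom 1 m) [:1, -1:]"
    unfolding D0_mult by (simp only: algebra_simps)
  also have "[:1,-2:] - [:1,-1:] = - [:0,1::complex:]" by simp
  also have "- [:0,1::complex:] * monom 1 m + [:1,-1:] * pcompose (monom 1 m) [:1, -1:] =
      pcompose (monom 1 (Suc m)) [:1, - 1:] - monom 1 (Suc m)"
    by (simp only: * **[symmetric] mult_minus_left diff_conv_add_uminus add.commute)
  finally show "[:1, - 2:] * (monom 1 m + [:1, - 1:] * D0 (monom 1 m)) =
    pcompose (monom 1 (Suc m)) [:1, - 1:] - monom 1 (Suc m)" .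
qed

lemma D0_monom_0: "D0 (monom 1 0) = 0"
  by (rule D0_unique) (simp add: monom_0 )

text \<open>Multiplying by \<open>x\<^sup>2\<close> keeps the top two coefficients free of truncated subtraction.\<close>

lemma coeff_D0_monom:
  assumes "m \<le> k"
  shows "coeff (monom 1 2 * D0 (monom 1 m)) k =
    (if k = m then (if even m then of_nat m / 2 else (1 - of_nat m) / 2)
     else if k = m + 1 \<and> odd m then 1 else 0)"
  using assms
proof (induction m arbitrary: k)
  case 0
  then show ?case using D0_monom_0 by simp
next
  case (Suc m)
  let ?E = "monom 1 2 * D0 (monom 1 m)"
  obtain j where k: "k = Suc j" "m \<le> j" using Suc.prems by (cases k) auto
  have "monom 1 2 * D0 (monom 1 (Suc m)) = monom 1 (m + 2) + ?E - pCons 0 ?E"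
    unfolding D0_monom_Suc by (simp add: algebra_simps mult_monom)
  then have "coeff (monom 1 2 * D0 (monom 1 (Suc m))) k =
     (if j = Suc m then 1 else 0) + coeff ?E (Suc j) - coeff ?E j"
    by (auto simp: k)
  then show ?case
    using Suc.IH[of j] Suc.IH[of "Suc j"] k by (auto simp: field_simps add_eq_0_iff)
qed

lemma D1_monom: "monom 1 1 * D1 (monom 1 m) = (if even m then 0 else - monom 1 m)"
proof -
  have "pcompose (monom 1 m) [:0, -1:] = (-1) ^ m * (monom 1 m :: complex poly)"
    by (induction m) (auto simp: monom_Suc monom_0 pcompose_pCons one_pCons)
  then have "[:0, 2:] * D1 (monom 1 m) = smult 2 (if even m then 0 else - monom 1 m)"
    unfolding D1_mult by (auto simp: minus_monom add_monom diff_monom smult_monom)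
  moreover have "[:0, 2:] = smult 2 (monom 1 1 :: complex poly)"
    by (simp add: monom_Suc monom_0)
  ultimately have "smult 2 (monom 1 1 * D1 (monom 1 m)) = smult 2 (if even m then 0 else - monom 1 m)"
    by (simp only: mult_smult_left)
  then have "smult (1/2) (smult 2 (monom 1 1 * D1 (monom 1 m))) =
      smult (1/2) (smult 2 (if even m then 0 else - monom 1 m))" by (rule arg_cong)
  then show ?thesis unfolding smult_smult by (simp del: One_nat_def)
qed

text \<open>For odd m, \<open>T0\<close> and \<open>T1\<close> each raise the degree by one, with
  new leading coefficients 1 and -1; these cancel only in the sum \<open>Y\<close>. For even m,
  \<open>D1\<close> kills the monomial and the diagonal entry gains m/2 from
  \<open>D0\<close>.\<close>

lemma coeff_Y_monom:
  assumes "m \<le> k"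
  shows "coeff (Y t0 u0 t1 u1 (monom 1 m)) k = (if k = m then eigval t0 t1 m else 0)"
proof -
  let ?c = "par_c t0 u0" and ?d = "par_d t0 u0" and ?a = "par_a t1 u1" and ?b = "par_b t1 u1"
  define F where "F = D0 (monom 1 m)"
  define E where "E = monom 1 2 * F"
  define f where "f = D1 (monom 1 m)"
  define e where "e = monom 1 1 * f"
  have E: "E = pCons 0 (pCons 0 F)" by (simp add: E_def numeral_2_eq_2 monom_Suc monom_0)
  have e: "e = pCons 0 f" by (simp add: e_def monom_Suc monom_0)
  have "[:?c, -1:] * [:?d, -1:] * F = smult (?c * ?d) F - smult (?c + ?d) (pCons 0 F) + E"
    unfolding E by (simp add: algebra_simps smult_add_left smult_diff_left)
  then have "coeff ([:?c, -1:] * [:?d, -1:] * F) k =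
      (?c * ?d) * coeff F k - (?c + ?d) * coeff (pCons 0 F) k + coeff E k"
    by (simp only: coeff_add coeff_diff coeff_smult)
  \<comment> \<open>\<open>F\<close> is \<open>E\<close> with indices lowered by two, so every
    coefficient is now read at an index \<ge> m, the range covered by \<open>E'\<close>
    below.\<close>
  also have "\<dots> = (?c * ?d) * coeff E (k+2) - (?c + ?d) * coeff E (k+1) + coeff E k"
    by (simp add: E)
  finally have 1: "coeff ([:?c, -1:] * [:?d, -1:] * F) k =
    (?c * ?d) * coeff E (k+2) - (?c + ?d) * coeff E (k+1) + coeff E k" .
  have "[:?a, 1:] * [:?b, 1:] * f = smult (?a * ?b) f + smult (?a + ?b) e + pCons 0 e"
    unfolding e by (simp add: algebra_simps smult_add_left)
  then have "coeff ([:?a, 1:] * [:?b, 1:] * f) k =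
      (?a * ?b) * coeff f k + (?a + ?b) * coeff e k + coeff (pCons 0 e) k" by simp
  also have "\<dots> = (?a * ?b) * coeff e (k+1) + (?a + ?b) * coeff e k + coeff (pCons 0 e) k"
    by (simp add: e)
  finally have 2: "coeff ([:?a, 1:] * [:?b, 1:] * f) k =
    (?a * ?b) * coeff e (k+1) + (?a + ?b) * coeff e k + coeff (pCons 0 e) k" .
  have e': "e = (if even m then 0 else - monom 1 m)"
    unfolding e_def f_def by (rule D1_monom)
  have E': "coeff E j = (if j = m then (if even m then of_nat m / 2 else (1 - of_nat m) / 2)
     else if j = m + 1 \<and> odd m then 1 else 0)" if "m \<le> j" for j
    unfolding E_def F_def using that by (rule coeff_D0_monom)
  have "coeff (Y t0 u0 t1 u1 (monom 1 m)) k =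
     (if k = m then t0 else 0) + coeff ([:?c, -1:] * [:?d, -1:] * F) k
      + (if k = m then t1 else 0) + coeff ([:?a, 1:] * [:?b, 1:] * f) k"
    by (simp only: Y_def T0_D0 T1_D1 F_def f_def coeff_add coeff_smult coeff_monom) auto
  also have "\<dots> = (if k = m then eigval t0 t1 m else 0)"
  proof (cases "even m")
    case True
    then obtain n where m: "m = 2 * n" by blast
    show ?thesis
      unfolding 1 2 using assms by (auto simp: E' e' m eigval_def)
  next
    case False
    then obtain n where m: "m = 2 * n + 1" by (elim oddE)
    have ac: "?a + ?b = 2 * t1" "?c + ?d = 2 * t0 + 1"
      by (simp_all add: par_a_def par_b_def par_c_def par_d_def)
    show ?thesis
      unfolding 1 2 ac using assms
      by (auto simp: E' e' m eigval_def coeff_pCons field_simps split: nat.splits)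
  qed
  finally show ?thesis .
qed

lemma coeff_Y:
  assumes "degree p \<le> m" "m \<le> k"
  shows "coeff (Y t0 u0 t1 u1 p) k = (if k = m then eigval t0 t1 m * coeff p m else 0)"
  using assms
proof (induction m arbitrary: p k)
  case 0
  then obtain c where p: "p = smult c (monom 1 0)"
    by (metis degree_0_id le_zero_eq mult.right_neutral smult_monom monom_0)
  show ?case unfolding p Y_smult coeff_smult using coeff_Y_monom[of 0 k] by simp
next
  case (Suc m)
  define q where "q = p - smult (coeff p (Suc m)) (monom 1 (Suc m))"
  have "coeff q i = 0" if "i > m" for i
    using that Suc.prems by (cases "i = Suc m") (auto simp: q_def coeff_eq_0)
  then have "degree q \<le> m" by (intro degree_le) auto
  then have "coeff (Y t0 u0 t1 u1 q) k = 0" using Suc.IH[of q k] Suc.prems by simp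
  moreover have "p = q + smult (coeff p (Suc m)) (monom 1 (Suc m))" by (simp add: q_def)
  then have "Y t0 u0 t1 u1 p = Y t0 u0 t1 u1 q
      + smult (coeff p (Suc m)) (Y t0 u0 t1 u1 (monom 1 (Suc m)))"
    by (metis Y_add Y_smult)
  ultimately show ?case
    using Suc.prems by (simp add: coeff_Y_monom)
qed

lemma eigval_inject:
  assumes "generic t0 u0 t1 u1" "eigval t0 t1 m = eigval t0 t1 n"
  shows "m = n"
proof -
  have neg: "t0 + t1 \<noteq> - (of_nat j / 2)" if "j \<ge> 1" for j :: nat
    using assms(1) that by (auto simp: generic_def Let_def)
  \<comment> \<open>Equality across parities forces t0 + t1 = -(i + j)/2. The odd index contributes
    j \<ge> 1, so this value is excluded by genericity even when i = 0.\<close>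
  have mixed: False
    if "t0 + t1 + of_nat i = - (t0 + t1 + of_nat j)" "j \<ge> 1" for i j :: nat
  proof -
    have "t0 + t1 = - (of_nat (i + j) / 2)"
      using that(1) by (simp add: field_simps) (metis add.commute add_eq_0_iff2 add.assoc mult_2_right)
    then show False using neg[of "i + j"] that(2) by simp
  qed
  show ?thesis
  proof (cases "even m"; cases "even n")
    assume "even m" "even n"
    then show ?thesis using assms(2) by (auto simp: eigval_def elim!: evenE)
  next
    assume "odd m" "odd n"
    then show ?thesis using assms(2) by (auto simp: eigval_def elim!: oddE)
  next
    assume "even m" "odd n"
    then show ?thesis
      using assms(2) mixed[of "m div 2" "(n + 1) div 2"] by (auto simp: eigval_def elim!: oddE)
  next
    assume "odd m" "even n"
    then show ?thesis
      using assms(2) mixed[of "n div 2" "(m + 1) div 2"] by (auto simp: eigval_def elim!: oddE)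
  qed
qed

text \<open>Back substitution in a triangular system: below degree m the diagonal entries of
  \<open>Y\<close> differ from the m-th eigenvalue, so the top coefficient can be solved for and
  removed. Vanishing of coefficients from k on replaces a degree bound, so that k = 0 describes the
  zero polynomial.\<close>

lemma Y_resolvent:
  assumes "generic t0 u0 t1 u1" "\<forall>i\<ge>k. coeff r i = 0" "k \<le> m"
  shows "\<exists>s. (\<forall>i\<ge>k. coeff s i = 0) \<and> Y t0 u0 t1 u1 s - smult (eigval t0 t1 m) s = r"
  using assms(2,3)
proof (induction k arbitrary: r)
  case 0
  then have "r = 0" by (simp add: poly_eq_iff)
  then show ?case using Y_smult[of t0 u0 t1 u1 0 0] by (intro exI[of _ 0]) simp
next
  case (Suc k)
  have ne: "eigval t0 t1 k - eigval t0 t1 m \<noteq> 0"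
    using eigval_inject[OF assms(1), of k m] Suc.prems(2) by auto
  define c where "c = coeff r k / (eigval t0 t1 k - eigval t0 t1 m)"
  define q where "q = smult c (monom 1 k)"
  define r' where "r' = r - (Y t0 u0 t1 u1 q - smult (eigval t0 t1 m) q)"
  have "\<forall>i\<ge>k. coeff r' i = 0"
    using Suc.prems(1) ne by (auto simp: r'_def q_def Y_smult coeff_Y_monom c_def field_simps)
  then obtain s where s: "\<forall>i\<ge>k. coeff s i = 0" "Y t0 u0 t1 u1 s - smult (eigval t0 t1 m) s = r'"
    using Suc.IH[of r'] Suc.prems(2) by auto
  have "Y t0 u0 t1 u1 (s + q) - smult (eigval t0 t1 m) (s + q) = r"
    using s(2) by (simp add: Y_add smult_add_right r'_def algebra_simps)
  moreover have "\<forall>i\<ge>Suc k. coeff (s + q) i = 0" using s(1) by (simp add: q_def)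
  ultimately show ?case by blast
qed

text \<open>Existence and uniqueness are what give the \<open>THE\<close> in
  \<open>wilson_poly\<close> a meaning.\<close>

lemma wilson_poly_eigen:
  assumes "generic t0 u0 t1 u1"
  shows "degree (wilson_poly t0 u0 t1 u1 m) = m" "lead_coeff (wilson_poly t0 u0 t1 u1 m) = 1"
    "Y t0 u0 t1 u1 (wilson_poly t0 u0 t1 u1 m) = smult (eigval t0 t1 m) (wilson_poly t0 u0 t1 u1 m)"
proof -
  let ?Q = "\<lambda>p. degree p = m \<and> lead_coeff p = 1 \<and> Y t0 u0 t1 u1 p = smult (eigval t0 t1 m) p"
  have "\<exists>!p. ?Q p"
  proof (rule ex_ex1I)
    \<comment> \<open>The defect of x^m as an eigenvector. Its degree is below m, so the resolvent
      yields a lower-order correction \<open>s\<close>.\<close>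
    define r where "r = smult (eigval t0 t1 m) (monom 1 m) - Y t0 u0 t1 u1 (monom 1 m)"
    have "\<forall>i\<ge>m. coeff r i = 0" by (auto simp: r_def coeff_Y_monom)
    then obtain s where s: "\<forall>i\<ge>m. coeff s i = 0" "Y t0 u0 t1 u1 s - smult (eigval t0 t1 m) s = r"
      using Y_resolvent[OF assms, of m r m] by auto
    define p where "p = monom 1 m + s"
    have c: "coeff p m = 1" using s(1) by (simp add: p_def)
    have "degree p \<le> m" using s(1) by (intro degree_le) (auto simp: p_def)
    with c have d: "degree p = m" by (metis le_antisym le_degree zero_neq_one)
    have "Y t0 u0 t1 u1 p = smult (eigval t0 t1 m) p"
      using s(2) by (simp add: p_def Y_add smult_add_right r_def algebra_simps)
    then show "\<exists>p. ?Q p" using c d by blast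
  next
    fix p q assume p: "?Q p" and q: "?Q q"
    \<comment> \<open>Both leading terms cancel, so a nonzero \<open>s\<close> would be an
      eigenvector of smaller degree with the same eigenvalue. The form with
      \<open>smult (-1)\<close> fits \<open>Y_add\<close> and \<open>Y_smult\<close>.\<close>
    define s where "s = p + smult (-1) q"
    have Ys: "Y t0 u0 t1 u1 s = smult (eigval t0 t1 m) s"
      using p q unfolding s_def Y_add Y_smult by (simp add: smult_diff_right)
    have "s = 0"
    proof (rule ccontr)
      assume "s \<noteq> 0"
      have "coeff s m = 0" using p q by (auto simp: s_def)
      moreover have "degree s \<le> m"
        using p q by (auto simp: s_def intro!: degree_diff_le)
      ultimately have less: "degree s \<noteq> m" using \<open>s \<noteq> 0\<close> by auto
      have "eigval t0 t1 (degree s) * lead_coeff s = eigval t0 t1 m * lead_coeff s"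
        by (metis coeff_Y coeff_smult order_refl Ys)
      then show False using \<open>s \<noteq> 0\<close> eigval_inject[OF assms] less by auto
    qed
    then show "p = q" by (simp add: s_def)
  qed
  then have "?Q (wilson_poly t0 u0 t1 u1 m)"
    unfolding wilson_poly_def by (rule theI')
  then show "degree (wilson_poly t0 u0 t1 u1 m) = m" "lead_coeff (wilson_poly t0 u0 t1 u1 m) = 1"
    "Y t0 u0 t1 u1 (wilson_poly t0 u0 t1 u1 m) = smult (eigval t0 t1 m) (wilson_poly t0 u0 t1 u1 m)"
    by auto
qed

section \<open>Polynomial families with one member in each degree\<close>

lemma graded_span:
  fixes p :: "nat \<Rightarrow> 'a::field poly"
  assumes vs: "vector_space (smult :: 'a \<Rightarrow> 'a poly \<Rightarrow> 'a poly)"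
    and "\<And>m. degree (p m) = m" and "\<And>m. p m \<noteq> 0"
  shows "module.span smult (range p) = UNIV"
proof -
  interpret vector_space "smult :: 'a \<Rightarrow> 'a poly \<Rightarrow> 'a poly" by (rule vs)
  have "\<forall>i\<ge>n. coeff f i = 0 \<Longrightarrow> f \<in> span (range p)" for n f
  proof (induction n arbitrary: f)
    case 0
    then have "f = 0" by (simp add: poly_eq_iff)
    then show ?case by (simp add: span_zero)
  next
    case (Suc n)
    define c where "c = coeff f n / coeff (p n) n"
    have ne: "coeff (p n) n \<noteq> 0" using assms(2,3)[of n] by (metis leading_coeff_0_iff)
    have "coeff (f - smult c (p n)) i = 0" if "i \<ge> n" for i
    proof (cases "i = n")
      case True
      then show ?thesis using ne by (simp add: c_def)
    next
      case False
      then have "coeff (p n) i = 0" using that assms(2)[of n] by (intro coeff_eq_0) auto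
      then show ?thesis using Suc.prems that False by simp
    qed
    then have "f - smult c (p n) \<in> span (range p)" by (intro Suc.IH) auto
    then have "(f - smult c (p n)) + smult c (p n) \<in> span (range p)"
      by (rule span_add) (auto intro: span_scale span_base)
    then show ?case by simp
  qed
  then have "f \<in> span (range p)" for f
    by (metis coeff_eq_0 less_eq_Suc_le)
  then show ?thesis by auto
qed

text \<open>Among the members with nonzero coefficient, the one of largest degree has a leading term
  that no other member can cancel, since degrees are distinct.\<close>

lemma graded_independent:
  fixes p :: "nat \<Rightarrow> 'a::field poly"
  assumes vs: "vector_space (smult :: 'a \<Rightarrow> 'a poly \<Rightarrow> 'a poly)"
    and deg: "\<And>m. degree (p m) = m" and nz: "\<And>m. p m \<noteq> 0"
  shows "\<not> module.dependent smult (range p)"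
proof
  interpret vector_space "smult :: 'a \<Rightarrow> 'a poly \<Rightarrow> 'a poly" by (rule vs)
  assume "dependent (range p)"
  then obtain t u where t: "finite t" "t \<subseteq> range p" "(\<Sum>v\<in>t. smult (u v) v) = 0" "\<exists>v\<in>t. u v \<noteq> 0"
    unfolding dependent_explicit by blast
  define s where "s = {v\<in>t. u v \<noteq> 0}"
  have s: "finite s" "s \<noteq> {}" using t by (auto simp: s_def)
  then obtain v where v: "v \<in> s" "\<forall>w\<in>s. degree w \<le> degree v"
    using Max_in[of "degree ` s"] Max_ge[of "degree ` s"] by (smt (verit) finite_imageI image_iff image_is_empty)
  have "coeff w (degree v) = 0" if w: "w \<in> s" "w \<noteq> v" for w
  proof -
    obtain i j where "w = p i" "v = p j" using w(1) v(1) t(2) unfolding s_def by blast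
    then have "degree w \<noteq> degree v" using w(2) deg by auto
    then show ?thesis using v(2) w(1) by (intro coeff_eq_0) (simp add: le_neq_implies_less)
  qed
  then have "(\<Sum>w\<in>s. u w * coeff w (degree v)) = u v * lead_coeff v"
    using s(1) v(1) by (subst sum.remove[of _ v]) auto
  moreover have "(\<Sum>w\<in>s. u w * coeff w (degree v)) = (\<Sum>w\<in>t. u w * coeff w (degree v))"
    using t(1) by (intro sum.mono_neutral_left) (auto simp: s_def)
  moreover have "(\<Sum>w\<in>t. u w * coeff w (degree v)) = coeff (\<Sum>w\<in>t. smult (u w) w) (degree v)"
    by (simp add: coeff_sum)
  ultimately have "u v * lead_coeff v = 0" using t(3) by simp
  moreover have "v \<noteq> 0" using v(1) t(2) nz by (auto simp: s_def)
  ultimately show False using v(1) by (simp add: s_def)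
qed

subsection \<open>Decay of the Gamma function in vertical strips\<close>

text \<open>Inequality between Gauss approximants, cross-multiplied. The factorials and the powers
  of n cancel, and what remains are the factors |s + m + it| / (s + m) = sqrt (1 + t^2/(s + m)^2),
  each decreasing in s.\<close>

lemma norm_Gamma_series_le:
  fixes s k t :: real
  assumes "0 < s" "s \<le> k"
  shows "norm (Gamma_series (Complex s t) n) * Gamma_series k n \<le>
    Gamma_series s n * norm (Gamma_series (Complex k t) n)"
proof -
  have norm_series: "norm (Gamma_series (Complex x t) n) = fact n * exp (x * ln n) / norm (pochhammer (Complex x t) (n + 1))"
    for x
    by (simp add: Gamma_series_def norm_mult norm_divide norm_exp)
  have real_series: "Gamma_series x n = fact n * exp (x * ln n) / pochhammer x (n + 1)" for x :: real
    by (simp add: Gamma_series_def)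
  have poch: "norm (pochhammer (Complex k t) m) * pochhammer s m \<le>
      pochhammer k m * norm (pochhammer (Complex s t) m)" for m
  proof (induction m)
    case (Suc m)
    have "norm (Complex (k + m) t) * (s + m) \<le> (k + m) * norm (Complex (s + m) t)"
    proof (rule power2_le_imp_le)
      have "t\<^sup>2 * (s + m)\<^sup>2 \<le> t\<^sup>2 * (k + m)\<^sup>2"
        using assms by (intro mult_left_mono power_mono) auto
      then show "(norm (Complex (k + m) t) * (s + m))\<^sup>2 \<le> ((k + m) * norm (Complex (s + m) t))\<^sup>2"
        unfolding power_mult_distrib cmod_power2 complex.sel
        by (simp add: distrib_left distrib_right mult.commute)
    qed (use assms in auto)
    moreover have "Complex k t + of_nat m = Complex (k + m) t" "Complex s t + of_nat m = Complex (s + m) t"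
      by (simp_all add: complex_eq_iff)
    ultimately show ?case
      using mult_mono[OF Suc.IH, of "norm (Complex (k + m) t) * (s + m)" "(k + m) * norm (Complex (s + m) t)"]
        assms pochhammer_pos[of k m] pochhammer_pos[of s m]
      by (simp add: pochhammer_rec' norm_mult mult_ac)
  qed auto
  have pos: "pochhammer s (n + 1) > 0" "pochhammer k (n + 1) > 0"
    using assms by (intro pochhammer_pos; simp)+
  have nz: "norm (pochhammer (Complex x t) (n + 1)) > 0" if "x > 0" for x
    using that by (simp add: pochhammer_eq_0_iff) (auto simp: complex_eq_iff)
  define A where "A = (fact n * exp (s * ln n)) * (fact n * exp (k * ln n))"
  have "A \<ge> 0" by (simp add: A_def)
  have "A / (norm (pochhammer (Complex s t) (n + 1)) * pochhammer k (n + 1))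
     \<le> A / (norm (pochhammer (Complex k t) (n + 1)) * pochhammer s (n + 1))"
    using poch[of "n + 1"] pos nz[of s] nz[of k] assms \<open>A \<ge> 0\<close>
    by (intro divide_left_mono mult_pos_pos) (auto simp: mult.commute)
  then show ?thesis
    unfolding norm_series real_series A_def by (simp add: mult_ac)
qed

text \<open>By Gauss's product, \<open>|\<Gamma>(s + it)| / \<Gamma>(s) = \<Prod>\<^sub>j (1 + t\<^sup>2/(s + j)\<^sup>2)\<^sup>-\<^sup>1\<^sup>/\<^sup>2\<close> is increasing in \<open>s\<close>.\<close>

lemma norm_Gamma_ratio_mono:
  fixes s k t :: real
  assumes "0 < s" "s \<le> k"
  shows "norm (Gamma (Complex s t)) * Gamma k \<le> Gamma s * norm (Gamma (Complex k t))"
proof (rule LIMSEQ_le)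
  show "(\<lambda>n. norm (Gamma_series (Complex s t) n) * Gamma_series k n) \<longlonglongrightarrow> norm (Gamma (Complex s t)) * Gamma k"
    by (intro tendsto_intros Gamma_series_LIMSEQ)
  show "(\<lambda>n. Gamma_series s n * norm (Gamma_series (Complex k t) n)) \<longlonglongrightarrow> Gamma s * norm (Gamma (Complex k t))"
    by (intro tendsto_intros Gamma_series_LIMSEQ)
qed (use norm_Gamma_series_le[OF assms] in blast)

text \<open>The reflection formula gives |Gamma(1 + it)|^2 = pi t / sinh (pi t).\<close>

lemma norm_Gamma_one_plus_ii:
  assumes "\<bar>t\<bar> \<ge> 1"
  shows "norm (Gamma (Complex 1 t)) \<le> 4 * \<bar>t\<bar> * exp (- (pi / 2 * \<bar>t\<bar>))"
proof -
  have c: "Complex 1 t = 1 + \<i> * t" "Complex 1 (-t) = 1 - \<i> * t" by (simp_all add: complex_eq_iff)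
  have "cnj (Gamma (Complex 1 t)) = Gamma (Complex 1 (-t))"
    by (simp add: cnj_Gamma complex_cnj)
  then have "(norm (Gamma (Complex 1 t)))\<^sup>2 = norm (Gamma (1 + \<i> * t) * Gamma (1 - \<i> * t))"
    by (metis c complex_mod_cnj norm_mult power2_eq_square)
  also have "Gamma (1 + \<i> * t) = \<i> * t * Gamma (\<i> * t)"
    using assms by (subst add.commute, subst Gamma_plus1) (auto elim!: nonpos_Ints_cases simp: complex_eq_iff)
  also have "\<i> * t * Gamma (\<i> * t) * Gamma (1 - \<i> * t) = \<i> * t * (of_real pi / sin (of_real pi * (\<i> * t)))"
    by (simp add: Gamma_reflection_complex mult.assoc)
  also have "norm \<dots> = \<bar>t\<bar> * pi / norm (sin (\<i> * of_real (pi * t)))"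
    by (simp add: norm_mult norm_divide mult_ac)
  also have "norm (sin (\<i> * of_real (pi * t))) = \<bar>sinh (pi * t)\<bar>"
  proof -
    have "sin (\<i> * of_real (pi * t)) = \<i> * of_real (sinh (pi * t))"
      by (simp add: sin_i_times sinh_field_def exp_minus flip: exp_of_real)
    then show ?thesis by (simp add: norm_mult)
  qed
  also have "\<bar>t\<bar> * pi / \<bar>sinh (pi * t)\<bar> \<le> \<bar>t\<bar> * pi / (exp (pi * \<bar>t\<bar>) / 4)"
  proof (intro divide_left_mono)
    have exp_bound: "a / 4 \<le> (a - b) / 2" if "b \<le> 1" "2 \<le> a" for a b :: real
      using that by simp
    have "1 \<le> pi * \<bar>t\<bar>"
      using assms pi_ge_two mult_mono[of 1 pi 1 "\<bar>t\<bar>"] by auto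
    then have "exp (- (pi * \<bar>t\<bar>)) \<le> 1" "exp (pi * \<bar>t\<bar>) \<ge> 2"
      using exp_ge_add_one_self[of "pi * \<bar>t\<bar>"] by (simp, linarith)
    then have "exp (pi * \<bar>t\<bar>) / 4 \<le> sinh (pi * \<bar>t\<bar>)"
      using exp_bound unfolding sinh_field_def by blast
    also have "\<dots> = \<bar>sinh (pi * t)\<bar>" by (auto simp: abs_if mult_less_0_iff)
    finally show "exp (pi * \<bar>t\<bar>) / 4 \<le> \<bar>sinh (pi * t)\<bar>" .
    then show "0 < \<bar>sinh (pi * t)\<bar> * (exp (pi * \<bar>t\<bar>) / 4)" using assms by auto
  qed auto
  also have "\<dots> = 4 * pi * \<bar>t\<bar> * exp (- (pi * \<bar>t\<bar>))" by (simp add: exp_minus divide_simps)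
  \<comment> \<open>The crude bounds pi < 4 and |t| \<le> t^2 make the right side a perfect
    square.\<close>
  also have "\<dots> \<le> 4 * 4 * \<bar>t\<bar>\<^sup>2 * exp (- (pi * \<bar>t\<bar>))"
    using assms pi_less_4 mult_mono[of pi 4 "\<bar>t\<bar>" "\<bar>t\<bar>\<^sup>2"] self_le_power[of "\<bar>t\<bar>" 2]
    by (intro mult_right_mono) auto
  also have "\<dots> = (4 * \<bar>t\<bar> * exp (- (pi / 2 * \<bar>t\<bar>)))\<^sup>2"
    by (simp add: power_mult_distrib flip: exp_double)
  finally show ?thesis by (rule power2_le_imp_le) auto
qed

text \<open>Each use of the functional equation costs a factor |k + 1 + it| \<le> (k + 2) |t|; these
  build up the factorial and the power.\<close>

lemma norm_Gamma_nat_plus_ii: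
  assumes "\<bar>t\<bar> \<ge> 1"
  shows "norm (Gamma (Complex (real (Suc k)) t)) \<le> 4 * fact (k + 1) * \<bar>t\<bar> ^ (k + 1) * exp (- (pi / 2 * \<bar>t\<bar>))"
proof (induction k)
  case 0
  then show ?case using norm_Gamma_one_plus_ii[OF assms] by simp
next
  case (Suc k)
  have "Complex (real (Suc (Suc k))) t = Complex (real (Suc k)) t + 1" by (simp add: complex_eq_iff)
  moreover have "Complex (real (Suc k)) t \<notin> \<int>\<^sub>\<le>\<^sub>0"
    using assms by (auto elim!: nonpos_Ints_cases simp: complex_eq_iff)
  ultimately have "norm (Gamma (Complex (real (Suc (Suc k))) t)) =
      norm (Complex (real (Suc k)) t) * norm (Gamma (Complex (real (Suc k)) t))"
    by (simp add: Gamma_plus1 norm_mult)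
  also have "norm (Complex (real (Suc k)) t) \<le> real (Suc k) * \<bar>t\<bar> + \<bar>t\<bar>"
  proof -
    have "real (Suc k) \<le> real (Suc k) * \<bar>t\<bar>" using assms by (simp add: mult_le_cancel_left1)
    then show ?thesis using cmod_le[of "Complex (real (Suc k)) t"] unfolding complex.sel by linarith
  qed
  also have "(real (Suc k) * \<bar>t\<bar> + \<bar>t\<bar>) * norm (Gamma (Complex (real (Suc k)) t)) \<le>
     (real (Suc k) * \<bar>t\<bar> + \<bar>t\<bar>) * (4 * fact (k + 1) * \<bar>t\<bar> ^ (k + 1) * exp (- (pi / 2 * \<bar>t\<bar>)))"
    by (intro mult_left_mono Suc.IH) auto
  also have "\<dots> = 4 * fact (Suc k + 1) * \<bar>t\<bar> ^ (Suc k + 1) * exp (- (pi / 2 * \<bar>t\<bar>))"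
    by (simp add: algebra_simps)
  finally show ?case by (simp add: mult_right_mono)
qed

text \<open>Translating by n moves the strip to real parts between 1 and 2n + 1. There monotonicity
  of the ratio compares with the line Re = 2n + 1, where the bound is known, and Gamma is bounded on
  the real interval. Translating back only helps: every factor of the Pochhammer symbol has modulus
  at least |Im z| \<ge> 1.\<close>

lemma Gamma_vertical_decay:
  fixes M :: real
  obtains C :: real and N :: nat where "C \<ge> 0"
    "\<And>z. \<bar>Re z\<bar> \<le> M \<Longrightarrow> \<bar>Im z\<bar> \<ge> 1 \<Longrightarrow> norm (Gamma z) \<le> C * \<bar>Im z\<bar> ^ N * exp (- (pi / 2 * \<bar>Im z\<bar>))"
proof -
  obtain n :: nat where n: "real n > M + 1" using reals_Archimedean2 by blast
  define k where "k = 2 * n"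
  have "compact (Gamma ` {1..real (Suc k)})"
    by (intro compact_continuous_image continuous_intros) (auto elim!: nonpos_Ints_cases)
  then have "bounded (Gamma ` {1..real (Suc k)})" by (rule compact_imp_bounded)
  then obtain B where B: "\<And>s. 1 \<le> s \<Longrightarrow> s \<le> real (Suc k) \<Longrightarrow> \<bar>Gamma s\<bar> \<le> B"
    unfolding bounded_iff by (metis atLeastAtMost_iff image_eqI real_norm_def)
  have "B \<ge> 0" using B[of 1] by auto
  have Gk: "Gamma (real (Suc k)) > 0" by (rule Gamma_real_pos) simp
  define C where "C = B * (4 * fact (k + 1)) / Gamma (real (Suc k))"
  show thesis
  proof (rule that)
    show "C \<ge> 0" using \<open>B \<ge> 0\<close> Gk by (simp add: C_def)
    fix z assume z: "\<bar>Re z\<bar> \<le> M" "\<bar>Im z\<bar> \<ge> 1"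
    define s where "s = Re z + n"
    have s: "1 \<le> s" "s \<le> real (Suc k)" using z n by (auto simp: s_def k_def)
    have zn: "z + of_nat n = Complex s (Im z)" by (simp add: s_def complex_eq_iff)
    have "norm (Gamma (Complex s (Im z))) * Gamma (real (Suc k)) \<le> Gamma s * norm (Gamma (Complex (real (Suc k)) (Im z)))"
      using s by (intro norm_Gamma_ratio_mono) auto
    also have "\<dots> \<le> B * (4 * fact (k + 1) * \<bar>Im z\<bar> ^ (k + 1) * exp (- (pi / 2 * \<bar>Im z\<bar>)))"
      using B[OF s] s z \<open>B \<ge> 0\<close> by (intro mult_mono norm_Gamma_nat_plus_ii) auto
    finally have 1: "norm (Gamma (z + of_nat n)) \<le> C * \<bar>Im z\<bar> ^ (k + 1) * exp (- (pi / 2 * \<bar>Im z\<bar>))"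
      using Gk unfolding zn C_def by (simp add: field_simps)
    have "z \<notin> \<int>\<^sub>\<le>\<^sub>0" using z(2) by (auto elim!: nonpos_Ints_cases)
    then have "Gamma (z + of_nat n) = pochhammer z n * Gamma z"
      by (simp add: pochhammer_Gamma Gamma_eq_zero_iff)
    moreover have "norm (pochhammer z m) \<ge> 1" for m
    proof (induction m)
      case (Suc m)
      have "1 \<le> norm (z + of_nat m)" using abs_Im_le_cmod[of "z + of_nat m"] z(2) by simp
      then show ?case using Suc.IH mult_mono[of 1 "norm (z + of_nat m)" 1 "norm (pochhammer z m)"]
        by (simp add: pochhammer_rec' norm_mult)
    qed auto
    ultimately have "norm (Gamma z) \<le> norm (Gamma (z + of_nat n))"
      using mult_right_mono[of 1 "norm (pochhammer z n)" "norm (Gamma z)"] by (simp add: norm_mult)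
    with 1 show "norm (Gamma z) \<le> C * \<bar>Im z\<bar> ^ (k + 1) * exp (- (pi / 2 * \<bar>Im z\<bar>))" by simp
  qed
qed

section \<open>A calculus of exponential rates in a vertical strip\<close>

text \<open>The power of |Im x| lets polynomials have rate 0 and makes rates add under products; a
  negative rate permits growth, as for the sine. The strip |Re x| \<le> 2 has room for 0 \<le> Re x
  \<le> 1, where the contour is joined to its translate.\<close>

definition strip_decay :: "real \<Rightarrow> (complex \<Rightarrow> complex) \<Rightarrow> bool" where
  "strip_decay q f \<longleftrightarrow> (\<exists>C N y0. 0 \<le> C \<and> 1 \<le> y0 \<and>
    (\<forall>x. \<bar>Re x\<bar> \<le> 2 \<longrightarrow> y0 \<le> \<bar>Im x\<bar> \<longrightarrow> norm (f x) \<le> C * \<bar>Im x\<bar> ^ N * exp (- (q * \<bar>Im x\<bar>))))"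

lemma strip_decay_mult:
  assumes "strip_decay q f" "strip_decay r g"
  shows "strip_decay (q + r) (\<lambda>x. f x * g x)"
proof -
  obtain C N y0 where f: "0 \<le> C" "1 \<le> y0"
    "\<And>x. \<bar>Re x\<bar> \<le> 2 \<Longrightarrow> y0 \<le> \<bar>Im x\<bar> \<Longrightarrow> norm (f x) \<le> C * \<bar>Im x\<bar> ^ N * exp (- (q * \<bar>Im x\<bar>))"
    using assms(1) unfolding strip_decay_def by blast
  obtain C' N' y0' where g: "0 \<le> C'" "1 \<le> y0'"
    "\<And>x. \<bar>Re x\<bar> \<le> 2 \<Longrightarrow> y0' \<le> \<bar>Im x\<bar> \<Longrightarrow> norm (g x) \<le> C' * \<bar>Im x\<bar> ^ N' * exp (- (r * \<bar>Im x\<bar>))"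
    using assms(2) unfolding strip_decay_def by blast
  have "norm (f x * g x) \<le> (C * C') * \<bar>Im x\<bar> ^ (N + N') * exp (- ((q + r) * \<bar>Im x\<bar>))"
    if "\<bar>Re x\<bar> \<le> 2" "max y0 y0' \<le> \<bar>Im x\<bar>" for x
  proof -
    have "norm (f x * g x) \<le> (C * \<bar>Im x\<bar> ^ N * exp (- (q * \<bar>Im x\<bar>))) * (C' * \<bar>Im x\<bar> ^ N' * exp (- (r * \<bar>Im x\<bar>)))"
      unfolding norm_mult using that f g by (intro mult_mono) auto
    also have "\<dots> = (C * C') * \<bar>Im x\<bar> ^ (N + N') * exp (- ((q + r) * \<bar>Im x\<bar>))"
      by (simp add: power_add exp_add[symmetric] exp_diff exp_minus field_simps)
    finally show ?thesis .
  qed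
  moreover have "0 \<le> C * C'" "1 \<le> max y0 y0'" using f g by auto
  ultimately show ?thesis unfolding strip_decay_def by blast
qed

lemma strip_decay_poly: "strip_decay 0 (poly p)"
proof (induction p)
  case 0
  then show ?case unfolding strip_decay_def by (intro exI[of _ "0::nat"] exI[of _ "1::real"]) auto
next
  case (pCons a p)
  obtain C N y0 where f: "0 \<le> C" "1 \<le> y0"
    "\<And>x. \<bar>Re x\<bar> \<le> 2 \<Longrightarrow> y0 \<le> \<bar>Im x\<bar> \<Longrightarrow> norm (poly p x) \<le> C * \<bar>Im x\<bar> ^ N * exp (- (0 * \<bar>Im x\<bar>))"
    using pCons.IH unfolding strip_decay_def by blast
  have "norm (poly (pCons a p) x) \<le> (norm a + 3 * C) * \<bar>Im x\<bar> ^ (N + 1) * exp (- (0 * \<bar>Im x\<bar>))"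
    if x: "\<bar>Re x\<bar> \<le> 2" "y0 \<le> \<bar>Im x\<bar>" for x
  proof -
    have 1: "1 \<le> \<bar>Im x\<bar>" using x f by simp
    \<comment> \<open>From |Re x| \<le> 2 and |Im x| \<ge> 1; this absorbs the factor x of the
      Horner step.\<close>
    have "norm x \<le> 3 * \<bar>Im x\<bar>" using cmod_le[of x] x 1 by simp
    then have "norm (x * poly p x) \<le> (3 * \<bar>Im x\<bar>) * (C * \<bar>Im x\<bar> ^ N)"
      unfolding norm_mult using f(3)[OF x] by (intro mult_mono) auto
    moreover have "norm a \<le> norm a * \<bar>Im x\<bar> ^ (N + 1)"
      using one_le_power[OF 1, of "N + 1"] by (simp only: mult_le_cancel_left1) auto
    ultimately have "norm a + norm (x * poly p x) \<le> (norm a + 3 * C) * \<bar>Im x\<bar> ^ (N + 1)"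
      by (simp add: algebra_simps)
    then show ?thesis using norm_triangle_ineq[of a "x * poly p x"] by simp
  qed
  moreover have "0 \<le> norm a + 3 * C" using f by auto
  ultimately show ?case using f(2) unfolding strip_decay_def by blast
qed

lemma norm_sin_le_exp: "norm (sin z) \<le> exp \<bar>Im z\<bar>" for z :: complex
proof -
  have "norm (sin z) = norm (exp (\<i> * z) - exp (- (\<i> * z))) / 2"
    by (simp add: sin_exp_eq' norm_mult norm_divide norm_minus_commute)
  also have "\<dots> \<le> (norm (exp (\<i> * z)) + norm (exp (- (\<i> * z)))) / 2"
    by (intro divide_right_mono norm_triangle_ineq4) auto
  also have "\<dots> \<le> (exp \<bar>Im z\<bar> + exp \<bar>Im z\<bar>) / 2"
    unfolding norm_exp by (intro divide_right_mono add_mono) auto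
  finally show ?thesis by simp
qed

lemma strip_decay_sin: "strip_decay (- 2 * pi) (\<lambda>x. sin (2 * of_real pi * x))"
  unfolding strip_decay_def
proof (intro exI[of _ "1::real"] exI[of _ "0::nat"] conjI allI impI)
  fix x
  show "norm (sin (2 * of_real pi * x)) \<le> 1 * \<bar>Im x\<bar> ^ 0 * exp (- (- 2 * pi * \<bar>Im x\<bar>))"
    using norm_sin_le_exp[of "2 * of_real pi * x"] by (simp add: abs_mult)
qed auto

text \<open>Adding e changes |Im x| by at most |Im e|, which costs only a constant. The threshold 1
  + |Im e| keeps the argument of Gamma at height at least 1.\<close>

lemma strip_decay_Gamma:
  assumes "s = 1 \<or> s = -1"
  shows "strip_decay (pi / 2) (\<lambda>x. Gamma (e + s * x))"
proof -
  have s: "\<bar>Re (s * x)\<bar> = \<bar>Re x\<bar>" "\<bar>Im (s * x)\<bar> = \<bar>Im x\<bar>" for x using assms by auto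
  obtain C N where C: "C \<ge> 0"
    "\<And>z. \<bar>Re z\<bar> \<le> \<bar>Re e\<bar> + 2 \<Longrightarrow> \<bar>Im z\<bar> \<ge> 1 \<Longrightarrow> norm (Gamma z) \<le> C * \<bar>Im z\<bar> ^ N * exp (- (pi / 2 * \<bar>Im z\<bar>))"
    using Gamma_vertical_decay by blast
  have "norm (Gamma (e + s * x)) \<le> (C * (1 + \<bar>Im e\<bar>) ^ N * exp (pi / 2 * \<bar>Im e\<bar>)) * \<bar>Im x\<bar> ^ N * exp (- (pi / 2 * \<bar>Im x\<bar>))"
    if x: "\<bar>Re x\<bar> \<le> 2" "1 + \<bar>Im e\<bar> \<le> \<bar>Im x\<bar>" for x
  proof -
    have im: "\<bar>Im x\<bar> - \<bar>Im e\<bar> \<le> \<bar>Im (e + s * x)\<bar>" "\<bar>Im (e + s * x)\<bar> \<le> \<bar>Im e\<bar> + \<bar>Im x\<bar>"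
      using s(2)[of x] by auto
    have re: "\<bar>Re (e + s * x)\<bar> \<le> \<bar>Re e\<bar> + 2" using s(1)[of x] x by auto
    have "\<bar>Im e\<bar> * 1 \<le> \<bar>Im e\<bar> * \<bar>Im x\<bar>" using x by (intro mult_left_mono) auto
    then have "\<bar>Im (e + s * x)\<bar> \<le> (1 + \<bar>Im e\<bar>) * \<bar>Im x\<bar>"
      using im by (simp add: algebra_simps)
    then have p: "\<bar>Im (e + s * x)\<bar> ^ N \<le> (1 + \<bar>Im e\<bar>) ^ N * \<bar>Im x\<bar> ^ N"
      by (metis abs_ge_zero power_mono power_mult_distrib)
    have "pi / 2 * (\<bar>Im x\<bar> - \<bar>Im e\<bar>) \<le> pi / 2 * \<bar>Im (e + s * x)\<bar>"
      using im by (intro mult_left_mono) auto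
    then have "exp (- (pi / 2 * \<bar>Im (e + s * x)\<bar>)) \<le> exp (pi / 2 * \<bar>Im e\<bar> + - (pi / 2 * \<bar>Im x\<bar>))"
      by (simp add: algebra_simps)
    then have E: "exp (- (pi / 2 * \<bar>Im (e + s * x)\<bar>)) \<le> exp (pi / 2 * \<bar>Im e\<bar>) * exp (- (pi / 2 * \<bar>Im x\<bar>))"
      by (simp only: exp_add)
    have "norm (Gamma (e + s * x)) \<le> C * \<bar>Im (e + s * x)\<bar> ^ N * exp (- (pi / 2 * \<bar>Im (e + s * x)\<bar>))"
      using C(2)[OF re] im x by simp
    also have "\<dots> \<le> C * ((1 + \<bar>Im e\<bar>) ^ N * \<bar>Im x\<bar> ^ N) * (exp (pi / 2 * \<bar>Im e\<bar>) * exp (- (pi / 2 * \<bar>Im x\<bar>)))"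
      using p E C(1) by (intro mult_mono) auto
    finally show ?thesis by (simp add: mult_ac)
  qed
  moreover have "0 \<le> C * (1 + \<bar>Im e\<bar>) ^ N * exp (pi / 2 * \<bar>Im e\<bar>)" "1 \<le> 1 + \<bar>Im e\<bar>" using C by auto
  ultimately show ?thesis unfolding strip_decay_def by blast
qed

lemma strip_decay_bound:
  assumes "strip_decay q f" "q > 1"
  obtains C y0 where "0 \<le> C" "1 \<le> y0"
    "\<And>x. \<bar>Re x\<bar> \<le> 2 \<Longrightarrow> y0 \<le> \<bar>Im x\<bar> \<Longrightarrow> norm (f x) \<le> C * exp (- \<bar>Im x\<bar>)"
proof -
  obtain C N y0 where f: "0 \<le> C" "1 \<le> y0"
    "\<And>x. \<bar>Re x\<bar> \<le> 2 \<Longrightarrow> y0 \<le> \<bar>Im x\<bar> \<Longrightarrow> norm (f x) \<le> C * \<bar>Im x\<bar> ^ N * exp (- (q * \<bar>Im x\<bar>))"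
    using assms(1) unfolding strip_decay_def by blast
  \<comment> \<open>The surplus rate q - 1 beats the power, which leaves the plain bound exp(-|Im
    x|).\<close>
  have "((\<lambda>y::real. y ^ N * exp (- ((q - 1) * y))) \<longlongrightarrow> 0) at_top"
    using assms(2) by real_asymp
  then have "\<forall>\<^sub>F y in at_top. y ^ N * exp (- ((q - 1) * y)) < 1"
    by (rule order_tendstoD) simp
  then obtain y1 where y1: "\<And>y. y \<ge> y1 \<Longrightarrow> y ^ N * exp (- ((q - 1) * y)) < 1"
    by (auto simp: eventually_at_top_linorder)
  show thesis
  proof (rule that[of C "max y0 y1"])
    fix x assume x: "\<bar>Re x\<bar> \<le> 2" "max y0 y1 \<le> \<bar>Im x\<bar>"
    have "norm (f x) \<le> C * \<bar>Im x\<bar> ^ N * exp (- (q * \<bar>Im x\<bar>))" using f(3) x by simp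
    also have "exp (- (q * \<bar>Im x\<bar>)) = exp (- ((q - 1) * \<bar>Im x\<bar>)) * exp (- \<bar>Im x\<bar>)"
      by (simp add: algebra_simps flip: exp_add)
    also have "C * \<bar>Im x\<bar> ^ N * (exp (- ((q - 1) * \<bar>Im x\<bar>)) * exp (- \<bar>Im x\<bar>)) =
      C * (\<bar>Im x\<bar> ^ N * exp (- ((q - 1) * \<bar>Im x\<bar>))) * exp (- \<bar>Im x\<bar>)" by simp
    also have "\<dots> \<le> C * 1 * exp (- \<bar>Im x\<bar>)"
      using y1[of "\<bar>Im x\<bar>"] x f(1) by (intro mult_right_mono mult_left_mono) auto
    finally show "norm (f x) \<le> C * exp (- \<bar>Im x\<bar>)" by simp
  qed (use f in auto)
qed

subsection \<open>Integrals over a symmetric contour\<close>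

text \<open>Common core of the upper and the lower half-line: \<open>K S\<close> is the bounded
  piece, \<open>T S\<close> the tail, \<open>h\<close> the dominating exponential and
  \<open>e S\<close> its integral over the tail.\<close>

lemma half_line_integral_limit:
  fixes f :: "real \<Rightarrow> complex" and K T :: "real \<Rightarrow> real set"
  assumes cont: "continuous_on A f"
    and split: "\<And>S. S \<ge> R \<Longrightarrow> A = K S \<union> T S" "\<And>S. negligible (K S \<inter> T S)"
    and K: "\<And>S. S \<ge> R \<Longrightarrow> f integrable_on K S" and T: "\<And>S. closed (T S)"
    and bound: "\<And>S y. S \<ge> L \<Longrightarrow> S \<ge> R \<Longrightarrow> y \<in> T S \<Longrightarrow> norm (f y) \<le> C * h y"
    and h: "\<And>S. (h has_integral e S) (T S)" and e: "(e \<longlongrightarrow> 0) at_top"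
  shows "((\<lambda>S. integral (K S) f) \<longlongrightarrow> integral A f) at_top"
proof -
  have eq: "norm (integral (K S) f - integral A f) \<le> C * e S" if S: "S \<ge> L" "S \<ge> R" for S
  proof -
    have hC: "((\<lambda>y. C * h y) has_integral C * e S) (T S)"
      by (intro has_integral_mult_right h)
    have "continuous_on (T S) f" using cont split(1)[OF S(2)] by (auto intro: continuous_on_subset)
    \<comment> \<open>Domination supplies integrability of the tail. It cannot be skipped:
      \<open>integral\<close> is 0 by default on non-integrable functions, and splitting it would
      not be justified.\<close>
    then have fT: "f integrable_on T S"
      using bound[OF S] hC T[of S]
      by (intro measurable_bounded_by_integrable_imp_integrable[of f "T S" "\<lambda>y. C * h y"]
          continuous_imp_measurable_on_sets_lebesgue) (auto intro: lebesgue_closedin)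
    have "integral A f = integral (K S) f + integral (T S) f"
      unfolding split(1)[OF S(2)] using K[OF S(2)] fT split(2) by (intro integral_Un) auto
    moreover have "norm (integral (T S) f) \<le> integral (T S) (\<lambda>y. C * h y)"
      using fT hC bound[OF S] by (intro integral_norm_bound_integral) auto
    ultimately show ?thesis using hC h[of S] by (simp add: integral_unique)
  qed
  have "((\<lambda>S. C * e S) \<longlongrightarrow> 0) at_top" using tendsto_mult_right_zero[OF e] by simp
  moreover have "\<forall>\<^sub>F S in at_top. norm (integral (K S) f - integral A f) \<le> C * e S"
    using eventually_ge_at_top[of L] eventually_ge_at_top[of R] by eventually_elim (rule eq)
  ultimately have "((\<lambda>S. integral (K S) f - integral A f) \<longlongrightarrow> 0) at_top"
    by (rule Lim_null_comparison[rotated])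
  then show ?thesis by (simp add: LIM_zero_iff)
qed

lemma integral_at_top_limit:
  fixes f :: "real \<Rightarrow> complex"
  assumes cont: "continuous_on {R..} f" and bound: "\<And>y. y \<ge> L \<Longrightarrow> norm (f y) \<le> C * exp (- y)"
  shows "((\<lambda>S. integral {R..S} f) \<longlongrightarrow> integral {R..} f) at_top"
proof (rule half_line_integral_limit[where T = "\<lambda>S. {S..}" and R = R and L = L and C = C
      and h = "\<lambda>y. exp (- y)" and e = "\<lambda>S. exp (- S)", OF cont])
  show "((\<lambda>y. exp (- y)) has_integral exp (- S)) {S..}" for S :: real
    using has_integral_exp_minus_to_infinity[of 1 S] by simp
  show "negligible ({R..S} \<inter> {S..})" for S
    by (rule negligible_subset[of "{S}"]) auto
  show "f integrable_on {R..S}" for S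
    using cont by (auto intro!: integrable_continuous_interval intro: continuous_on_subset)
  show "((\<lambda>S. exp (- S)) \<longlongrightarrow> (0::real)) at_top" by real_asymp
qed (use bound in auto)

lemma integral_at_bot_limit:
  fixes f :: "real \<Rightarrow> complex"
  assumes cont: "continuous_on {..-R} f" and bound: "\<And>y. y \<le> - L \<Longrightarrow> norm (f y) \<le> C * exp y"
  shows "((\<lambda>S. integral {-S..-R} f) \<longlongrightarrow> integral {..-R} f) at_top"
proof (rule half_line_integral_limit[where T = "\<lambda>S. {..-S}" and R = R and L = L and C = C
      and h = exp and e = "\<lambda>S. exp (- S)", OF cont])
  show "(exp has_integral exp (- S)) {..-S}" for S :: real
  proof -
    have 1: "((\<lambda>y. exp (- y)) has_integral exp (- S)) {S..}"
      using has_integral_exp_minus_to_infinity[of 1 S] by simp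
    then have "(\<lambda>y. exp (- y)) absolutely_integrable_on {S..}"
      by (intro nonnegative_absolutely_integrable_1) auto
    then have "exp absolutely_integrable_on {..-S} \<and> integral {..-S} exp = exp (- S)"
      using 1 by (subst has_absolute_integral_reflect_real[symmetric, where A = "{S..}"])
        (auto simp: integral_unique)
    then show ?thesis
      using set_lebesgue_integral_eq_integral(1) by (auto simp: has_integral_iff)
  qed
  show "negligible ({-S..-R} \<inter> {..-S})" for S
    by (rule negligible_subset[of "{-S}"]) auto
  show "f integrable_on {-S..-R}" for S
    using cont by (auto intro!: integrable_continuous_interval intro: continuous_on_subset)
  show "((\<lambda>S. exp (- S)) \<longlongrightarrow> (0::real)) at_top" by real_asymp
qed (use bound in auto)

section \<open>Transformed paths and arcs with equal image\<close>

lemma negate_linepath: "uminus \<circ> linepath a b = linepath (- a) (- b :: complex)"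
  by (simp add: fun_eq_iff linepath_def algebra_simps)

lemma translate_linepath: "(+) c \<circ> linepath a b = linepath (c + a) (c + b :: complex)"
  by (simp add: fun_eq_iff linepath_def scaleR_conv_of_real algebra_simps)

lemma winding_number_translate: "winding_number ((+) c \<circ> p) w = winding_number p (w - c)"
proof -
  have "winding_number ((+) c \<circ> p) w = winding_number (\<lambda>t. p t - (w - c)) 0"
    by (subst winding_number_offset) (simp add: algebra_simps)
  then show ?thesis by (metis winding_number_offset)
qed

text \<open>An arc is a homeomorphism onto its image, so h = g o (k o h) with k its inverse, and h
  is a reparametrization of g, monotone or not. Needed because set symmetry of a contour says
  nothing about how g is parametrized.\<close>

lemma arc_same_image_homotopic:
  fixes g h :: "real \<Rightarrow> complex"
  assumes "arc g" "path h" "path_image h \<subseteq> path_image g"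
    and "pathstart h = pathstart g" "pathfinish h = pathfinish g"
  shows "homotopic_paths (path_image g) g h"
proof -
  obtain k where k: "homeomorphism {0..1} (path_image g) g k"
    using homeomorphism_arc[OF assms(1)] by blast
  have h: "h t \<in> path_image g" if "t \<in> {0..1}" for t
    using assms(3) that by (auto simp: path_image_def)
  show ?thesis
  proof (rule homotopic_paths_reparametrize[where f = "k \<circ> h"])
    have "continuous_on (h ` {0..1}) k"
      using homeomorphism_cont2[OF k] assms(3) continuous_on_subset by (auto simp: path_image_def)
    then show "continuous_on {0..1} (k \<circ> h)"
      using assms(2) by (intro continuous_on_compose) (auto simp: path_def)
    show "k \<circ> h \<in> {0..1} \<rightarrow> {0..1}"
      using h k by (auto simp: homeomorphism_def)
    show "(k \<circ> h) 0 = 0" "(k \<circ> h) 1 = 1"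
      using assms(4,5) homeomorphism_apply1[OF k, of 0] homeomorphism_apply1[OF k, of 1]
      by (simp_all add: pathstart_def pathfinish_def)
    show "h t = g ((k \<circ> h) t)" if "t \<in> {0..1}" for t
      using homeomorphism_apply2[OF k h[OF that]] by simp
  qed (use assms(1) arc_imp_path in auto)
qed

section \<open>Truncations of a symmetric contour\<close>

locale symmetric_contour =
  fixes R :: real and g :: "real \<Rightarrow> complex"
  assumes R: "R > 0" and valid: "valid_path g" and arc: "arc g"
    and ends: "pathstart g = - (\<i> * of_real R)" "pathfinish g = \<i> * of_real R"
    and disj: "path_image g \<inter> {\<i> * of_real y | y. \<bar>y\<bar> > R} = {}"
    and symm: "uminus ` contour_set R g = contour_set R g"
begin

definition trunc :: "real \<Rightarrow> real \<Rightarrow> complex" where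
  "trunc S = linepath (- (\<i> * of_real S)) (- (\<i> * of_real R)) +++ g +++
     linepath (\<i> * of_real R) (\<i> * of_real S)"

lemma valid_trunc: "valid_path (trunc S)"
  unfolding trunc_def by (intro valid_path_join valid) (auto simp: ends)

lemma ends_trunc: "pathstart (trunc S) = - (\<i> * of_real S)" "pathfinish (trunc S) = \<i> * of_real S"
  by (simp_all add: trunc_def)

lemma vertical_segments:
  assumes "S \<ge> R"
  shows "closed_segment (\<i> * of_real R) (\<i> * of_real S) = {\<i> * of_real y | y. R \<le> y \<and> y \<le> S}"
    and "closed_segment (- (\<i> * of_real S)) (- (\<i> * of_real R)) = {\<i> * of_real y | y. - S \<le> y \<and> y \<le> - R}"
proof -
  show "closed_segment (\<i> * of_real R) (\<i> * of_real S) = {\<i> * of_real y | y. R \<le> y \<and> y \<le> S}"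
    using assms by (auto simp: closed_segment_same_Re closed_segment_eq_real_ivl complex_eq_iff)
  show "closed_segment (- (\<i> * of_real S)) (- (\<i> * of_real R)) = {\<i> * of_real y | y. - S \<le> y \<and> y \<le> - R}"
    using assms by (auto simp: closed_segment_same_Re closed_segment_eq_real_ivl complex_eq_iff)
qed

lemma path_image_trunc:
  assumes "S \<ge> R"
  shows "path_image (trunc S) = path_image g \<union> {\<i> * of_real y | y. R \<le> \<bar>y\<bar> \<and> \<bar>y\<bar> \<le> S}"
proof -
  have "path_image (trunc S) = {\<i> * of_real y | y. - S \<le> y \<and> y \<le> - R} \<union> (path_image g \<union> {\<i> * of_real y | y. R \<le> y \<and> y \<le> S})"
    unfolding trunc_def by (simp add: path_image_join ends vertical_segments[OF assms])
  moreover have "{\<i> * of_real y | y. - S \<le> y \<and> y \<le> - R} \<union> {\<i> * of_real y | y. R \<le> y \<and> y \<le> S} =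
     {\<i> * of_real y | y. R \<le> \<bar>y\<bar> \<and> \<bar>y\<bar> \<le> S}"
  proof -
    have "(- S \<le> y \<and> y \<le> - R) \<or> (R \<le> y \<and> y \<le> S) \<longleftrightarrow> R \<le> \<bar>y\<bar> \<and> \<bar>y\<bar> \<le> S" for y
      using R by linarith
    then show ?thesis by blast
  qed
  ultimately show ?thesis by blast
qed

lemma path_image_trunc_subset: "S \<ge> R \<Longrightarrow> path_image (trunc S) \<subseteq> contour_set R g"
  unfolding contour_set_def by (subst path_image_trunc) auto

text \<open>The symmetry is assumed for the whole contour. A point of the path could be reflected
  onto a half-line only at an endpoint iR or -iR, because the path avoids the open half-lines, and
  both endpoints belong to the path.\<close>

lemma path_image_symmetric: "z \<in> path_image g \<Longrightarrow> - z \<in> path_image g"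
proof (rule ccontr)
  assume z: "z \<in> path_image g" "- z \<notin> path_image g"
  have "- z \<in> contour_set R g" using symm z(1) by (force simp: contour_set_def)
  then obtain y where y: "- z = \<i> * of_real y" "\<bar>y\<bar> \<ge> R"
    using z(2) by (auto simp: contour_set_def)
  then have "z = \<i> * of_real (- y)" by (metis minus_equation_iff mult_minus_right of_real_minus)
  then have "\<not> \<bar>- y\<bar> > R" using disj z(1) by blast
  with y(2) have "y = R \<or> y = - R" by linarith
  then have "- z = pathstart g \<or> - z = pathfinish g" using y(1) ends by auto
  then show False using z(2) pathstart_in_path_image pathfinish_in_path_image by metis
qed

text \<open>Reflection z -> -z changes the sign of dz and reverses the direction of the contour; the
  two signs cancel. The vertical segments are exchanged, and the middle path goes to one homotopic
  to itself.\<close>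

lemma contour_integral_trunc_uminus:
  assumes "open U" "F holomorphic_on U" "contour_set R g \<subseteq> U" "S \<ge> R"
  shows "contour_integral (trunc S) (\<lambda>z. F (- z)) = contour_integral (trunc S) F"
proof -
  let ?m = "linepath (- (\<i> * of_real S)) (- (\<i> * of_real R))"
  let ?p = "linepath (\<i> * of_real R) (\<i> * of_real S)"
  have sub: "path_image ?m \<subseteq> contour_set R g" "path_image g \<subseteq> contour_set R g" "path_image ?p \<subseteq> contour_set R g"
    using vertical_segments[OF assms(4)] R by (auto simp: contour_set_def)
  have intF: "F contour_integrable_on p" if "valid_path p" "path_image p \<subseteq> contour_set R g" for p
    using contour_integrable_holomorphic_simple[OF assms(2,1) that(1)] that(2) assms(3) by blast
  have mU: "(\<lambda>z. F (- z)) holomorphic_on uminus ` U"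
  proof -
    have "(\<lambda>z. - z) holomorphic_on uminus ` U" by (intro holomorphic_intros)
    then have "F \<circ> uminus holomorphic_on uminus ` U"
      by (rule holomorphic_on_compose_gen[OF _ assms(2)]) auto
    then show ?thesis by (simp add: o_def)
  qed
  have "open (uminus ` U)" using assms(1) by (rule open_negations)
  moreover have "contour_set R g \<subseteq> uminus ` U" using symm assms(3) by blast
  ultimately have intF': "(\<lambda>z. F (- z)) contour_integrable_on p" if "valid_path p" "path_image p \<subseteq> contour_set R g" for p
    using contour_integrable_holomorphic_simple[OF mU _ that(1)] that(2) by blast
  \<comment> \<open>The reflected path, reversed so as to start and end where \<open>g\<close> does;
    its image lies in that of \<open>g\<close>.\<close>
  let ?h = "uminus \<circ> reversepath g"
  have vh: "valid_path ?h" by (intro valid_path_negatepath) (simp add: valid)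
  have "homotopic_paths (path_image g) g ?h"
  proof (rule arc_same_image_homotopic[OF arc])
    show "path_image ?h \<subseteq> path_image g"
      using path_image_symmetric by (auto simp: path_image_compose)
  qed (use vh ends in \<open>auto simp: valid_path_imp_path pathstart_compose pathfinish_compose\<close>)
  then have "homotopic_paths U g ?h"
    using sub(2) assms(3) by (blast intro: homotopic_paths_subset)
  then have "contour_integral g F = contour_integral ?h F"
    by (rule Cauchy_theorem_homotopic_paths[OF _ assms(1,2) valid vh])
  also have "\<dots> = contour_integral g (\<lambda>z. F (- z))"
    by (simp add: contour_integral_negatepath contour_integral_reversepath valid)
  finally have g: "contour_integral g (\<lambda>z. F (- z)) = contour_integral g F" by simp
  have lin: "contour_integral (linepath a b) (\<lambda>z. F (- z)) = contour_integral (linepath (- b) (- a)) F" for a b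
    using contour_integral_negatepath[of "linepath a b" F] contour_integral_reversepath[of "linepath (- b) (- a)" F]
    by (simp add: negate_linepath)
  have "contour_integral (trunc S) (\<lambda>z. F (- z)) =
      contour_integral ?m (\<lambda>z. F (- z)) + (contour_integral g (\<lambda>z. F (- z)) + contour_integral ?p (\<lambda>z. F (- z)))"
    unfolding trunc_def using sub intF' valid
    by (subst contour_integral_join contour_integrable_joinI valid_path_join; (simp add: ends)?)+
  also have "\<dots> = contour_integral ?p F + (contour_integral g F + contour_integral ?m F)"
    unfolding g lin by simp
  also have "\<dots> = contour_integral (trunc S) F"
    unfolding trunc_def using sub intF valid
    by (subst contour_integral_join contour_integrable_joinI valid_path_join; (simp add: ends)?)+
  finally show ?thesis .
qed

text \<open>Passes from the half-line integrals in the form to finite paths, on which reflection and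
  Cauchy's theorem act.\<close>

lemma full_contour_integral_limit:
  assumes cont: "continuous_on (contour_set R g) F"
    and int: "F contour_integrable_on g"
    and bound: "\<And>y. \<bar>y\<bar> \<ge> L \<Longrightarrow> norm (F (\<i> * of_real y)) \<le> C * exp (- \<bar>y\<bar>)"
  shows "((\<lambda>S. contour_integral (trunc S) F) \<longlongrightarrow> full_contour_integral R g F) at_top"
proof -
  let ?f = "\<lambda>y. F (\<i> * of_real y) * \<i>"
  have contf: "continuous_on {y. \<bar>y\<bar> \<ge> R} ?f"
    by (intro continuous_intros continuous_on_compose2[OF cont]) (auto simp: contour_set_def)
  have 1: "((\<lambda>S. integral {R..S} ?f) \<longlongrightarrow> integral {R..} ?f) at_top"
  proof (intro integral_at_top_limit[where L = "max 0 L" and C = C] continuous_on_subset[OF contf])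
    fix y assume "y \<ge> max 0 L"
    then show "norm (?f y) \<le> C * exp (- y)" using bound[of y] by (simp add: norm_mult)
  qed auto
  have 2: "((\<lambda>S. integral {-S..-R} ?f) \<longlongrightarrow> integral {..-R} ?f) at_top"
  proof (intro integral_at_bot_limit[where L = "max 0 L" and C = C] continuous_on_subset[OF contf])
    fix y assume "y \<le> - max 0 L"
    then show "norm (?f y) \<le> C * exp y" using bound[of y] by (simp add: norm_mult)
  qed auto
  have eq: "integral {-S..-R} ?f + contour_integral g F + integral {R..S} ?f = contour_integral (trunc S) F"
    if "S > R" for S
  proof -
    let ?m = "linepath (- (\<i> * of_real S)) (- (\<i> * of_real R))"
    let ?p = "linepath (\<i> * of_real R) (\<i> * of_real S)"
    have "continuous_on (path_image ?m) F" "continuous_on (path_image ?p) F"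
      using vertical_segments[of S] that R
      by (auto intro!: continuous_on_subset[OF cont] simp: contour_set_def)
    then have "F contour_integrable_on ?m" "F contour_integrable_on ?p"
      by (auto intro!: contour_integrable_continuous_linepath)
    then have "contour_integral (trunc S) F = contour_integral ?m F + (contour_integral g F + contour_integral ?p F)"
      unfolding trunc_def using int valid
      by (subst contour_integral_join contour_integrable_joinI valid_path_join; (simp add: ends)?)+
    moreover have "contour_integral ?m F = \<i> * integral {-S..-R} (\<lambda>y. F (Complex 0 y))"
      using that by (intro contour_integral_linepath_same_Re) auto
    moreover have "contour_integral ?p F = \<i> * integral {R..S} (\<lambda>y. F (Complex 0 y))"
      using that by (intro contour_integral_linepath_same_Re) auto
    moreover have "Complex 0 y = \<i> * of_real y" for y by (simp add: complex_eq_iff)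
    ultimately show ?thesis by (simp add: mult.commute[of _ "\<i>"])
  qed
  have "((\<lambda>S. integral {-S..-R} ?f + contour_integral g F + integral {R..S} ?f) \<longlongrightarrow> full_contour_integral R g F) at_top"
    unfolding full_contour_integral_def by (intro tendsto_intros 1 2)
  then show ?thesis
    by (rule Lim_transform_eventually) (rule eventually_mono[OF eventually_gt_at_top[of R] eq])
qed

section \<open>Cauchy's theorem for the contour and its translate\<close>

text \<open>Up the truncated contour, across to the right, down its translate, back to the left.
  Apart from the two horizontal pieces, integrating H over it gives the integral of H(z) - H(z+1)
  over \<open>trunc S\<close>.\<close>

definition loop :: "real \<Rightarrow> real \<Rightarrow> complex" where
  "loop S = trunc S +++ (linepath (\<i> * of_real S) (1 + \<i> * of_real S) +++
     (reversepath ((+) 1 \<circ> trunc S) +++ linepath (1 - \<i> * of_real S) (- (\<i> * of_real S))))"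

lemma ends_translate: "pathstart ((+) 1 \<circ> trunc S) = 1 - \<i> * of_real S"
  "pathfinish ((+) 1 \<circ> trunc S) = 1 + \<i> * of_real S"
  by (simp_all add: pathstart_compose pathfinish_compose ends_trunc)

lemma valid_translate: "valid_path ((+) 1 \<circ> trunc S)"
  by (simp only: valid_path_translation_eq valid_trunc)

lemma valid_loop: "valid_path (loop S)"
  unfolding loop_def
  by (intro valid_path_join valid_trunc valid_path_linepath valid_path_imp_reverse valid_translate)
    (simp_all add: ends_trunc ends_translate)

lemma ends_loop: "pathstart (loop S) = - (\<i> * of_real S)" "pathfinish (loop S) = - (\<i> * of_real S)"
  by (simp_all add: loop_def ends_trunc)

lemma path_image_loop:
  "path_image (loop S) = path_image (trunc S) \<union> closed_segment (\<i> * of_real S) (1 + \<i> * of_real S) \<union>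
     (+) 1 ` path_image (trunc S) \<union> closed_segment (1 - \<i> * of_real S) (- (\<i> * of_real S))"
  unfolding loop_def
  by (simp add: path_image_join ends_trunc ends_translate path_image_compose Un_assoc)

lemma horizontal_segment:
  "z \<in> closed_segment (\<i> * of_real S) (1 + \<i> * of_real S) \<Longrightarrow> Im z = S \<and> 0 \<le> Re z \<and> Re z \<le> 1"
  "z \<in> closed_segment (1 - \<i> * of_real S) (- (\<i> * of_real S)) \<Longrightarrow> Im z = - S \<and> 0 \<le> Re z \<and> Re z \<le> 1"
  by (auto simp: in_segment complex_eq_iff algebra_simps)

text \<open>The right half of the diamond |Re z| + |Im z| = S, used to close the truncated
  contour.\<close>

lemma diamond_segment:
  assumes "S \<ge> 0"
  shows "z \<in> closed_segment (\<i> * of_real S) (of_real S) \<Longrightarrow> 0 \<le> Re z \<and> Re z + \<bar>Im z\<bar> = S"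
    and "z \<in> closed_segment (of_real S) (- (\<i> * of_real S)) \<Longrightarrow> 0 \<le> Re z \<and> Re z + \<bar>Im z\<bar> = S"
proof -
  assume "z \<in> closed_segment (\<i> * of_real S) (of_real S)"
  then obtain u where u: "0 \<le> u" "u \<le> 1" "Re z = u * S" "Im z = (1 - u) * S"
    by (auto simp: in_segment complex_eq_iff)
  then have "\<bar>Im z\<bar> = (1 - u) * S" using assms by (simp add: abs_mult)
  then show "0 \<le> Re z \<and> Re z + \<bar>Im z\<bar> = S" using u assms by (simp add: algebra_simps)
next
  assume "z \<in> closed_segment (of_real S) (- (\<i> * of_real S))"
  then obtain u where u: "0 \<le> u" "u \<le> 1" "Re z = (1 - u) * S" "Im z = - (u * S)"
    by (auto simp: in_segment complex_eq_iff)
  then have "\<bar>Im z\<bar> = u * S" "0 \<le> (1 - u) * S" using assms by (simp_all add: abs_mult)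
  then show "0 \<le> Re z \<and> Re z + \<bar>Im z\<bar> = S" unfolding u by (simp add: algebra_simps)
qed

lemma closed_contour_set: "closed (contour_set R g)"
proof -
  have "{\<i> * of_real y | y. \<bar>y\<bar> \<ge> R} = {z. Re z = 0} \<inter> {z. \<bar>Im z\<bar> \<ge> R}"
    by (auto simp: complex_eq_iff)
  moreover have "closed ({z. Re z = 0} \<inter> {z. \<bar>Im z\<bar> \<ge> R})"
    by (intro closed_Int closed_Collect_eq closed_Collect_le continuous_intros)
  ultimately show ?thesis
    unfolding contour_set_def using valid by (auto intro!: closed_Un closed_path_image valid_path_imp_path)
qed

text \<open>With q the diamond half from iS to -iS, the loop is the closed curve
  \<open>T +++ q\<close>, minus its translate by 1, plus the curve \<open>thin\<close> made of what
  is left over. The first two contributions cancel, as winding about w after translation is winding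
  about w - 1; \<open>thin\<close> contributes 0. Since S > 2B, all of X lies inside the
  diamond.\<close>

lemma winding_number_loop_eq:
  assumes "S \<ge> R" and X: "connected X" "compact X" "X \<inter> contour_set R g = {}" "w \<in> X" "w - 1 \<in> X"
    and small: "\<And>z. z \<in> X \<Longrightarrow> norm z \<le> B" and S: "S > 2 * B"
  shows "winding_number (loop S) w = 0"
proof -
  have "B \<ge> 0" using small[OF X(4)] norm_ge_zero order_trans by blast
  have "S > 0" using \<open>B \<ge> 0\<close> S by simp
  define T where "T = trunc S"
  define top where "top = linepath (\<i> * of_real S) (1 + \<i> * of_real S)"
  define bot where "bot = linepath (1 - \<i> * of_real S) (- (\<i> * of_real S))"
  define q where "q = linepath (\<i> * of_real S) (of_real S) +++ linepath (of_real S) (- (\<i> * of_real S))"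
  define q1 where "q1 = (+) 1 \<circ> q"
  have paths: "path T" "path top" "path bot" "path q" "path q1" "path ((+) 1 \<circ> T)"
    by (auto simp: T_def top_def bot_def q_def q1_def path_translation_eq valid_path_imp_path valid_trunc)
  have ends': "pathstart T = - (\<i> * of_real S)" "pathfinish T = \<i> * of_real S"
    "pathstart top = \<i> * of_real S" "pathfinish top = 1 + \<i> * of_real S"
    "pathstart bot = 1 - \<i> * of_real S" "pathfinish bot = - (\<i> * of_real S)"
    "pathstart q = \<i> * of_real S" "pathfinish q = - (\<i> * of_real S)"
    "pathstart q1 = 1 + \<i> * of_real S" "pathfinish q1 = 1 - \<i> * of_real S"
    "pathstart ((+) 1 \<circ> T) = 1 - \<i> * of_real S" "pathfinish ((+) 1 \<circ> T) = 1 + \<i> * of_real S"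
    by (simp_all add: T_def ends_trunc top_def bot_def q_def q1_def pathstart_compose pathfinish_compose)
  have q: "0 \<le> Re z \<and> Re z + \<bar>Im z\<bar> = S" if "z \<in> path_image q" for z
    using that diamond_segment[of S z] \<open>S > 0\<close> by (auto simp: q_def path_image_join)
  have q1: "1 \<le> Re z \<and> Re z - 1 + \<bar>Im z\<bar> = S" if "z \<in> path_image q1" for z
    using that q by (force simp: q1_def path_image_compose)
  have seg: "0 \<le> Re z \<and> \<bar>Im z\<bar> = S" if "z \<in> path_image top \<or> z \<in> path_image bot" for z
    using that horizontal_segment[of z S] \<open>S > 0\<close> by (auto simp: top_def bot_def)
  have near: "Re z + \<bar>Im z\<bar> < S" "\<bar>Im z\<bar> < S" if "z \<in> X" for z
    using small[OF that] S \<open>B \<ge> 0\<close> abs_Re_le_cmod[of z] abs_Im_le_cmod[of z] by linarith+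
  have T: "path_image T \<subseteq> contour_set R g" unfolding T_def by (rule path_image_trunc_subset) fact
  have nT: "z \<notin> path_image T" "z \<notin> path_image q" if "z \<in> X" for z
    using that T X(3) q[of z] near[OF that] by auto
  have nw: "w \<notin> path_image top" "w \<notin> path_image bot" "w \<notin> path_image q1"
    using seg[of w] q1[of w] near[OF X(4)] near[OF X(5)] by auto
  have nT1: "w \<notin> path_image ((+) 1 \<circ> T)" using nT(1)[OF X(5)] by (force simp: path_image_compose)

  \<comment> \<open>The connected set X contains w and w - 1 and meets neither the contour nor the
    diamond.\<close>
  have "winding_number (T +++ q) w = winding_number (T +++ q) (w - 1)"
    using X nT by (intro winding_number_eq[where S = X]) (auto simp: paths ends' path_image_join)
  then have 1: "winding_number T w + winding_number q w = winding_number T (w - 1) + winding_number q (w - 1)"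
    using nT X by (simp add: winding_number_join paths ends')

  \<comment> \<open>The two horizontal segments together with the diamond half and its translate;
    the contour itself no longer occurs.\<close>
  define thin where "thin = top +++ (q1 +++ (bot +++ reversepath q))"
  have p_thin: "path thin" "pathfinish thin = pathstart thin"
    by (auto simp: thin_def paths ends')
  have i_thin: "path_image thin = path_image top \<union> (path_image q1 \<union> (path_image bot \<union> path_image q))"
    by (simp add: thin_def path_image_join paths ends')
  \<comment> \<open>Moving w horizontally to the left never meets \<open>thin\<close> and ends in Re
    z < 0, outside the half-plane containing it.\<close>
  define v where "v = w - of_real (\<bar>Re w\<bar> + 1)"
  have ray: "Im z = Im w \<and> Re z \<le> Re w" if "z \<in> closed_segment w v" for z
  proof -
    obtain u where u: "0 \<le> u" "Re z = Re w - u * (\<bar>Re w\<bar> + 1)" "Im z = Im w"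
      using \<open>z \<in> closed_segment w v\<close> by (auto simp: in_segment v_def complex_eq_iff algebra_simps)
    then show ?thesis by simp
  qed
  have "z \<notin> path_image thin" if "z \<in> closed_segment w v" for z
  proof
    assume "z \<in> path_image thin"
    then have "\<bar>Im z\<bar> = S \<or> Re z + \<bar>Im z\<bar> = S \<or> Re z - 1 + \<bar>Im z\<bar> = S"
      using q[of z] q1[of z] seg[of z] unfolding i_thin Un_iff by metis
    moreover have "Im z = Im w" "Re z \<le> Re w" using ray[OF that] by auto
    ultimately show False using near[OF X(4)] by linarith
  qed
  then have "winding_number thin w = winding_number thin v"
    by (intro winding_number_eq[where S = "closed_segment w v"] p_thin) auto
  also have "\<dots> = 0"
  proof (rule winding_number_zero_outside[of _ "{z. 0 \<le> Re z}"])
    show "convex {z. 0 \<le> Re z}" using convex_halfspace_Re_ge[of 0] by simp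
    show "path_image thin \<subseteq> {z. 0 \<le> Re z}"
    proof
      fix z assume "z \<in> path_image thin"
      then have "0 \<le> Re z \<or> 1 \<le> Re z"
        using q[of z] q1[of z] seg[of z] unfolding i_thin Un_iff by metis
      then show "z \<in> {z. 0 \<le> Re z}" by auto
    qed
  qed (auto simp: p_thin v_def)
  finally have "winding_number top w + (winding_number q1 w + (winding_number bot w - winding_number q w)) = 0"
    unfolding thin_def using nw nT X
    by (simp add: winding_number_join winding_number_reversepath paths ends' path_image_join)
  moreover have "winding_number q1 w = winding_number q (w - 1)"
    unfolding q1_def by (rule winding_number_translate)
  moreover have "winding_number (loop S) w = winding_number T w + (winding_number top w +
      (- winding_number T (w - 1) + winding_number bot w))"
    unfolding loop_def T_def[symmetric] top_def[symmetric] bot_def[symmetric] using nw nT nT1 X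
    by (simp add: winding_number_join winding_number_reversepath paths ends' path_image_join winding_number_translate)
  ultimately show ?thesis using 1 by algebra
qed

text \<open>A component may be unbounded, so a path in it from w to w - 1 serves as the compact
  connected set that fixes how large S must be.\<close>

lemma winding_number_loop_component:
  assumes X: "X \<in> components (- contour_set R g)" "w \<in> X" "w - 1 \<in> X"
  shows "\<forall>\<^sub>F S in at_top. winding_number (loop S) w = 0"
proof -
  have "open X" by (rule open_components[OF _ X(1)]) (simp add: open_Compl closed_contour_set)
  moreover have "connected X" by (rule in_components_connected[OF X(1)])
  ultimately have "path_connected X" by (simp add: connected_open_path_connected)
  then obtain p where p: "path p" "path_image p \<subseteq> X" "pathstart p = w" "pathfinish p = w - 1"
    unfolding path_connected_def using X(2,3) by metis
  obtain B where B: "\<And>z. z \<in> path_image p \<Longrightarrow> norm z \<le> B"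
    using bounded_path_image[OF p(1)] by (auto simp: bounded_iff)
  have "path_image p \<inter> contour_set R g = {}" using p(2) in_components_subset[OF X(1)] by blast
  moreover have "w \<in> path_image p" "w - 1 \<in> path_image p"
    using p(3,4) pathstart_in_path_image pathfinish_in_path_image by metis+
  ultimately have zero: "winding_number (loop S) w = 0" if "S \<ge> R" "S > 2 * B" for S
    using p(1) B that by (intro winding_number_loop_eq[OF _ connected_path_image compact_path_image, of S p w B])
  show ?thesis
    using eventually_ge_at_top[of R] eventually_gt_at_top[of "2 * B"] by eventually_elim (rule zero)
qed

text \<open>The contour and its translate by 1 may intersect, so no region between them is used: the loop has
  winding number 0 about each pole \<open>w\<close> because \<open>w\<close> and \<open>w - 1\<close> lie on the same side of the contour.\<close>

lemma shifted_contour_limit: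
  assumes D: "open D" "H holomorphic_on D" "contour_set R g \<subseteq> D" "(+) 1 ` contour_set R g \<subseteq> D"
    and im: "\<And>z. \<bar>Im z\<bar> \<ge> L \<Longrightarrow> z \<in> D"
    and comp: "\<And>w. w \<notin> D \<Longrightarrow> \<exists>X\<in>components (- contour_set R g). w \<in> X \<and> w - 1 \<in> X"
    and fin: "\<And>b. finite {w. w \<notin> D \<and> \<bar>Re w\<bar> \<le> b}"
    and C: "0 \<le> C" and bound: "\<And>z. \<bar>Re z\<bar> \<le> 2 \<Longrightarrow> \<bar>Im z\<bar> \<ge> L \<Longrightarrow> norm (H z) \<le> C * exp (- \<bar>Im z\<bar>)"
  shows "((\<lambda>S. contour_integral (trunc S) (\<lambda>z. H z - H (z + 1))) \<longlongrightarrow> 0) at_top"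
proof -
  \<comment> \<open>This bounds the indentations, so every loop stays in |Re z| \<le> b + 1.
    Finitely many excluded points lie there, hence one threshold for S serves all of them.\<close>
  obtain b where b: "\<And>z. z \<in> path_image g \<Longrightarrow> norm z \<le> b"
    using bounded_path_image[OF valid_path_imp_path[OF valid]] by (auto simp: bounded_iff)
  have "b \<ge> 0"
    using b[OF pathstart_in_path_image] norm_ge_zero[of "pathstart g"] by linarith
  have "\<forall>\<^sub>F S in at_top. \<forall>w\<in>{w. w \<notin> D \<and> \<bar>Re w\<bar> \<le> b + 1}. winding_number (loop S) w = 0"
  proof (rule eventually_ball_finite[OF fin], safe)
    fix w assume "w \<notin> D"
    then obtain X where "X \<in> components (- contour_set R g)" "w \<in> X" "w - 1 \<in> X"
      using comp by blast
    then show "\<forall>\<^sub>F S in at_top. winding_number (loop S) w = 0"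
      by (rule winding_number_loop_component)
  qed
  then have "\<forall>\<^sub>F S in at_top. norm (contour_integral (trunc S) (\<lambda>z. H z - H (z + 1))) \<le> 2 * C * exp (- S)"
    using eventually_ge_at_top[of R] eventually_ge_at_top[of L] eventually_ge_at_top[of 0]
  proof eventually_elim
    fix S assume wind: "\<forall>w\<in>{w. w \<notin> D \<and> \<bar>Re w\<bar> \<le> b + 1}. winding_number (loop S) w = 0"
      and S: "S \<ge> R" "S \<ge> L" "S \<ge> 0"
    have strip: "\<bar>Re z\<bar> \<le> b" if "z \<in> path_image (trunc S)" for z
      using that b[of z] abs_Re_le_cmod[of z] \<open>b \<ge> 0\<close> by (auto simp: path_image_trunc[OF S(1)])
    let ?top = "linepath (\<i> * of_real S) (1 + \<i> * of_real S)"
    let ?bot = "linepath (1 - \<i> * of_real S) (- (\<i> * of_real S))"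
    have "z \<in> D" if "z \<in> closed_segment (\<i> * of_real S) (1 + \<i> * of_real S)" for z
      using horizontal_segment(1)[OF that] im[of z] S by simp
    moreover have "z \<in> D" if "z \<in> closed_segment (1 - \<i> * of_real S) (- (\<i> * of_real S))" for z
      using horizontal_segment(2)[OF that] im[of z] S by simp
    ultimately have segs: "closed_segment (\<i> * of_real S) (1 + \<i> * of_real S) \<subseteq> D"
      "closed_segment (1 - \<i> * of_real S) (- (\<i> * of_real S)) \<subseteq> D"
      by blast+
    have wide: "\<bar>Re z\<bar> \<le> b + 1" if z: "z \<in> path_image (loop S)" for z
    proof -
      consider "z \<in> path_image (trunc S)" | "z - 1 \<in> path_image (trunc S)"
        | "z \<in> closed_segment (\<i> * of_real S) (1 + \<i> * of_real S)"
        | "z \<in> closed_segment (1 - \<i> * of_real S) (- (\<i> * of_real S))"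
        using z unfolding path_image_loop by fastforce
      then show ?thesis
        using strip[of z] strip[of "z - 1"] horizontal_segment[of z S] \<open>b \<ge> 0\<close> by cases auto
    qed
    have sub: "path_image (trunc S) \<subseteq> D" "(+) 1 ` path_image (trunc S) \<subseteq> D"
      using path_image_trunc_subset[OF S(1)] D(3,4) by blast+
    have "(H has_contour_integral 0) (loop S)"
    proof (rule Cauchy_theorem_global[OF D(1,2) valid_loop])
      show "path_image (loop S) \<subseteq> D" using segs sub unfolding path_image_loop by blast
      fix w assume w: "w \<notin> D"
      show "winding_number (loop S) w = 0"
      proof (cases "\<bar>Re w\<bar> \<le> b + 1")
        \<comment> \<open>Points beyond the convex strip that holds the loop have winding number 0
          for every such S.\<close>
        case False
        show ?thesis
        proof (rule winding_number_zero_outside)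
          show "convex ({z. Re z \<le> b + 1} \<inter> {z. Re z \<ge> - (b + 1)})"
            by (intro convex_Int convex_halfspace_Re_le convex_halfspace_Re_ge)
          show "path_image (loop S) \<subseteq> {z. Re z \<le> b + 1} \<inter> {z. Re z \<ge> - (b + 1)}"
          proof
            fix z assume "z \<in> path_image (loop S)"
            then show "z \<in> {z. Re z \<le> b + 1} \<inter> {z. Re z \<ge> - (b + 1)}"
              using wide[of z] by (auto simp: abs_le_iff)
          qed
        qed (use False in \<open>auto simp: valid_loop valid_path_imp_path ends_loop\<close>)
      qed (use wind w in auto)
    qed (simp add: ends_loop)
    then have "contour_integral (loop S) H = 0" by (rule contour_integral_unique)
    moreover have int: "H contour_integrable_on p" if "valid_path p" "path_image p \<subseteq> D" for p
      using contour_integrable_holomorphic_simple[OF D(2,1) that] .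
    have i: "H contour_integrable_on trunc S" "H contour_integrable_on ((+) 1 \<circ> trunc S)"
       "H contour_integrable_on ?top" "H contour_integrable_on ?bot"
      using sub segs by (intro int valid_trunc valid_translate; simp add: path_image_compose)+
    have "contour_integral (loop S) H = contour_integral (trunc S) H + (contour_integral ?top H +
       (contour_integral (reversepath ((+) 1 \<circ> trunc S)) H + contour_integral ?bot H))"
      unfolding loop_def using i
      by (subst contour_integral_join contour_integrable_joinI valid_path_join;
          (simp add: ends_trunc ends_translate valid_trunc valid_translate contour_integrable_reversepath)?)+
    moreover have "contour_integral (reversepath ((+) 1 \<circ> trunc S)) H = - contour_integral (trunc S) (\<lambda>z. H (z + 1))"
      by (simp add: contour_integral_reversepath valid_translate contour_integral_translate)
    moreover have "contour_integral (trunc S) (\<lambda>z. H z - H (z + 1)) =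
       contour_integral (trunc S) H - contour_integral (trunc S) (\<lambda>z. H (z + 1))"
      using i by (intro contour_integral_diff) (simp_all add: contour_integrable_translate)
    ultimately have "contour_integral (trunc S) (\<lambda>z. H z - H (z + 1)) =
       - (contour_integral ?top H + contour_integral ?bot H)"
      by algebra
    then have "norm (contour_integral (trunc S) (\<lambda>z. H z - H (z + 1))) \<le>
        norm (contour_integral ?top H) + norm (contour_integral ?bot H)"
      by (simp only: norm_minus_cancel norm_triangle_ineq)
    moreover have "norm (contour_integral ?top H) \<le> C * exp (- S) * norm (1 + \<i> * of_real S - \<i> * of_real S)"
    proof (rule contour_integral_bound_linepath[OF i(3)])
      fix z assume "z \<in> closed_segment (\<i> * of_real S) (1 + \<i> * of_real S)"
      then show "norm (H z) \<le> C * exp (- S)" using horizontal_segment(1)[of z S] bound[of z] S by simp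
    qed (use C in auto)
    moreover have "norm (contour_integral ?bot H) \<le> C * exp (- S) * norm (- (\<i> * of_real S) - (1 - \<i> * of_real S))"
    proof (rule contour_integral_bound_linepath[OF i(4)])
      fix z assume "z \<in> closed_segment (1 - \<i> * of_real S) (- (\<i> * of_real S))"
      then show "norm (H z) \<le> C * exp (- S)" using horizontal_segment(2)[of z S] bound[of z] S by simp
    qed (use C in auto)
    ultimately show "norm (contour_integral (trunc S) (\<lambda>z. H z - H (z + 1))) \<le> 2 * C * exp (- S)" by simp
  qed
  moreover have "((\<lambda>S. 2 * C * exp (- S)) \<longlongrightarrow> 0) at_top" by real_asymp
  ultimately show ?thesis by (rule Lim_null_comparison)
qed

end

subsection \<open>Symmetry of the form\<close>

lemma poly_D0: "(1 - 2 * x) * poly (D0 f) x = poly f (1 - x) - poly f x"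
  using arg_cong[OF D0_mult[of f], of "\<lambda>p. poly p x"] by (simp add: poly_pcompose algebra_simps)

lemma poly_D1: "2 * x * poly (D1 f) x = poly f (- x) - poly f x"
  using arg_cong[OF D1_mult[of f], of "\<lambda>p. poly p x"] by (simp add: poly_pcompose algebra_simps)

text \<open>Numerator and denominator of the divided difference both change sign. Cancelling 1 - 2x
  fails only at the fixed point 1/2, where nothing is to be shown.\<close>

lemma poly_D0_reflect: "poly (D0 f) (1 - x) = poly (D0 f) x"
proof (cases "x = 1 / 2")
  case True
  then have "1 - x = x" by (simp add: field_simps)
  then show ?thesis by (rule arg_cong)
next
  case False
  have "(1 - 2 * x) * poly (D0 f) (1 - x) = (1 - 2 * x) * poly (D0 f) x"
  proof -
    have "(1 - 2 * (1 - x)) * poly (D0 f) (1 - x) = poly f x - poly f (1 - x)"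
      using poly_D0[of "1 - x" f] by simp
    with poly_D0[of x f] show ?thesis by algebra
  qed
  moreover have "1 - 2 * x \<noteq> 0" using False by (simp add: field_simps)
  ultimately show ?thesis by (metis mult_cancel_left)
qed

lemma poly_D1_reflect: "poly (D1 f) (- x) = poly (D1 f) x"
proof (cases "x = 0")
  case False
  have "2 * x * poly (D1 f) (- x) = 2 * x * poly (D1 f) x"
  proof -
    have "2 * (- x) * poly (D1 f) (- x) = poly f x - poly f (- x)"
      using poly_D1[of "- x" f] by simp
    with poly_D1[of x f] show ?thesis by algebra
  qed
  then show ?thesis using False by simp
qed simp

text \<open>The Wronskian of f and h for the divided difference: (1 - 2x) times it is f(1-x) h(x) -
  f(x) h(1-x), a quotient of two functions that are odd under the reflection.\<close>

definition Q0 :: "complex poly \<Rightarrow> complex poly \<Rightarrow> complex poly" where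
  "Q0 f h = D0 f * h - f * D0 h"

definition Q1 :: "complex poly \<Rightarrow> complex poly \<Rightarrow> complex poly" where
  "Q1 f h = D1 f * h - f * D1 h"

lemma poly_Q0_reflect: "poly (Q0 f h) (1 - x) = poly (Q0 f h) x"
proof -
  have e: "poly f (1 - x) = poly f x + (1 - 2 * x) * poly (D0 f) x" for f
    using poly_D0[of x f] by simp
  show ?thesis
    unfolding Q0_def poly_diff poly_mult poly_D0_reflect e[of f] e[of h] by algebra
qed

lemma poly_Q1_reflect: "poly (Q1 f h) (- x) = poly (Q1 f h) x"
proof -
  have e: "poly f (- x) = poly f x + 2 * x * poly (D1 f) x" for f
    using poly_D1[of x f] by simp
  show ?thesis
    unfolding Q1_def poly_diff poly_mult poly_D1_reflect e[of f] e[of h] by algebra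
qed

text \<open>The scalar parts t0 and t1 of the operators cancel, so only divided differences
  survive.\<close>

lemma Y_commutator:
  "Y t0 u0 t1 u1 f * h - f * Y t0 u0 t1 u1 h =
    [:par_a t1 u1, 1:] * [:par_b t1 u1, 1:] * Q1 f h + [:par_c t0 u0, -1:] * [:par_d t0 u0, -1:] * Q0 f h"
proof -
  define A where "A = [:par_a t1 u1, 1:] * [:par_b t1 u1, 1:]"
  define B where "B = [:par_c t0 u0, -1:] * [:par_d t0 u0, -1:]"
  have "smult t p = [:t:] * p" for t and p :: "complex poly" by simp
  then show ?thesis
    unfolding Y_def T0_D0 T1_D1 Q0_def Q1_def A_def[symmetric] B_def[symmetric]
    by (simp only: algebra_simps)
qed

text \<open>By the reflection formula the denominator becomes an entire factor. Where 2x is an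
  integer, both sides are 0.\<close>

lemma weight_eq:
  assumes "a = par_a t1 u1" "b = par_b t1 u1" "c = par_c t0 u0" "d = par_d t0 u0"
  shows "weight t0 u0 t1 u1 x =
    Gamma (a + x) * Gamma (a + 1 - x) * Gamma (b + x) * Gamma (b + 1 - x) *
      (Gamma (c + x) * Gamma (c - x)) * (Gamma (d + x) * Gamma (d - x)) * (sin (2 * of_real pi * x) / of_real pi)"
proof -
  have "y / (Gamma (2 * x) * Gamma (1 - 2 * x)) = y * (sin (2 * of_real pi * x) / of_real pi)" for y
    by (simp add: Gamma_reflection_complex mult.commute mult.left_commute)
  then show ?thesis unfolding weight_def Let_def assms by simp
qed

lemma strip_decay_Gamma_plus: "strip_decay (pi / 2) (\<lambda>x. Gamma (e + x))"
  using strip_decay_Gamma[of 1 e] by simp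

lemma strip_decay_Gamma_minus: "strip_decay (pi / 2) (\<lambda>x. Gamma (e - x))"
  using strip_decay_Gamma[of "-1" e] by simp

section \<open>Poles of the Gamma factors and their side of the contour\<close>

text \<open>What is removed are the points -(e + n) and e + s + n. The value s = 0 fits the form's
  integrand and the part odd under x -> -x; s = 1 fits the part odd under x -> 1 - x.\<close>

definition pole_free :: "complex set \<Rightarrow> complex \<Rightarrow> complex set" where
  "pole_free E s = {x. \<forall>e\<in>E. e + x \<notin> \<int>\<^sub>\<le>\<^sub>0 \<and> e + s - x \<notin> \<int>\<^sub>\<le>\<^sub>0}"

lemma open_pole_free:
  assumes "finite E"
  shows "open (pole_free E s)"
proof -
  have "pole_free E s = (\<Inter>e\<in>E. - ((\<lambda>x. e + x) -` \<int>\<^sub>\<le>\<^sub>0 \<union> (\<lambda>x. e + s - x) -` \<int>\<^sub>\<le>\<^sub>0))"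
    by (auto simp: pole_free_def)
  also have "open \<dots>"
    using assms by (intro open_INT ballI open_Compl closed_Un continuous_closed_vimage) (auto intro!: continuous_intros)
  finally show ?thesis .
qed

lemma not_nonpos_Int_plus_one: "z \<notin> \<int>\<^sub>\<le>\<^sub>0 \<Longrightarrow> z + 1 \<notin> \<int>\<^sub>\<le>\<^sub>0"
  using plus_one_in_nonpos_Ints_imp by blast

lemma Gamma_holomorphic_pole_free:
  assumes "e \<in> E"
  shows "(\<lambda>x. Gamma (e + x)) holomorphic_on pole_free E s"
    and "(\<lambda>x. Gamma (e + s - x)) holomorphic_on pole_free E s"
    and "(\<lambda>x. Gamma (e + s + 1 - x)) holomorphic_on pole_free E s"
    and "(\<lambda>x. Gamma (e + 1 + x)) holomorphic_on pole_free E s"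
proof -
  have "e + x \<notin> \<int>\<^sub>\<le>\<^sub>0 \<and> e + s - x \<notin> \<int>\<^sub>\<le>\<^sub>0 \<and> e + s + 1 - x \<notin> \<int>\<^sub>\<le>\<^sub>0 \<and> e + 1 + x \<notin> \<int>\<^sub>\<le>\<^sub>0" if "x \<in> pole_free E s" for x
    using that assms not_nonpos_Int_plus_one[of "e + x"] not_nonpos_Int_plus_one[of "e + s - x"]
    by (auto simp: pole_free_def algebra_simps)
  then show "(\<lambda>x. Gamma (e + x)) holomorphic_on pole_free E s"
    "(\<lambda>x. Gamma (e + s - x)) holomorphic_on pole_free E s"
    "(\<lambda>x. Gamma (e + s + 1 - x)) holomorphic_on pole_free E s"
    "(\<lambda>x. Gamma (e + 1 + x)) holomorphic_on pole_free E s"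
    by (auto intro!: holomorphic_Gamma' holomorphic_intros)
qed

lemma finite_not_pole_free:
  assumes "finite E"
  shows "finite {w. w \<notin> pole_free E 1 \<and> \<bar>Re w\<bar> \<le> B}"
proof -
  define N where "N e = nat \<lceil>B + \<bar>Re e\<bar>\<rceil>" for e :: complex
  have N: "n \<le> N e" if "\<bar>Re e + real n\<bar> \<le> B \<or> \<bar>Re e + 1 + real n\<bar> \<le> B" for e n
  proof -
    have "real n \<le> B + \<bar>Re e\<bar>" using that by linarith
    then show ?thesis unfolding N_def by linarith
  qed
  have "w \<in> (\<Union>e\<in>E. (\<lambda>n. - (e + of_nat n)) ` {..N e} \<union> (\<lambda>n. e + 1 + of_nat n) ` {..N e})"
    if w: "w \<notin> pole_free E 1" "\<bar>Re w\<bar> \<le> B" for w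
  proof -
    obtain e where e: "e \<in> E" "e + w \<in> \<int>\<^sub>\<le>\<^sub>0 \<or> e + 1 - w \<in> \<int>\<^sub>\<le>\<^sub>0" using w(1) by (auto simp: pole_free_def)
    from e(2) show ?thesis
    proof
      assume "e + w \<in> \<int>\<^sub>\<le>\<^sub>0"
      then obtain n where "e + w = - of_nat n" by (rule nonpos_Ints_cases')
      then have n: "w = - (e + of_nat n)" by algebra
      then have "n \<le> N e" using w(2) by (intro N) (simp add: abs_if split: if_splits)
      then show ?thesis using n e(1) by blast
    next
      assume "e + 1 - w \<in> \<int>\<^sub>\<le>\<^sub>0"
      then obtain n where "e + 1 - w = - of_nat n" by (rule nonpos_Ints_cases')
      then have n: "w = e + 1 + of_nat n" by (simp add: algebra_simps)
      then have "n \<le> N e" using w(2) by (intro N) simp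
      then show ?thesis using n e(1) by blast
    qed
  qed
  then have "{w. w \<notin> pole_free E 1 \<and> \<bar>Re w\<bar> \<le> B} \<subseteq>
      (\<Union>e\<in>E. (\<lambda>n. - (e + of_nat n)) ` {..N e} \<union> (\<lambda>n. e + 1 + of_nat n) ` {..N e})" by blast
  then show ?thesis by (rule finite_subset) (use assms in auto)
qed

text \<open>For real s, all poles lie on the lines of height Im e and -Im e.\<close>

lemma pole_free_high:
  assumes "finite E"
  obtains L where "\<And>z s. Im s = 0 \<Longrightarrow> \<bar>Im z\<bar> \<ge> L \<Longrightarrow> z \<in> pole_free E s"
proof
  fix z s :: complex
  assume s: "Im s = 0" and z: "\<bar>Im z\<bar> \<ge> (\<Sum>e\<in>E. \<bar>Im e\<bar>) + 1"
  have "\<bar>Im e\<bar> < \<bar>Im z\<bar>" if "e \<in> E" for e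
    using member_le_sum[of e E "\<lambda>e. \<bar>Im e\<bar>"] assms that z by simp
  then show "z \<in> pole_free E s"
    using s by (fastforce simp: pole_free_def elim!: nonpos_Ints_cases' dest: arg_cong[of _ _ Im])
qed

locale wilson_contour = symmetric_contour +
  fixes E :: "complex set"
  assumes fin_E: "finite E"
    and sep: "separates (contour_set R g) {e + of_nat n | e n. e \<in> E} (uminus ` {e + of_nat n | e n. e \<in> E})"
begin

text \<open>The last claim is where the shift by 1 pays off: for w = -(e + n) the point w - 1 is the
  next member of the same sequence, and for w = e + 1 + n it is the previous one, e + n, still to be
  separated on the right.\<close>

lemma contour_pole_free: "contour_set R g \<subseteq> pole_free E 0"
  and translate_pole_free: "(+) 1 ` contour_set R g \<subseteq> pole_free E 1"
  and same_side: "w \<notin> pole_free E 1 \<Longrightarrow> \<exists>X\<in>components (- contour_set R g). w \<in> X \<and> w - 1 \<in> X"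
proof -
  obtain U V where UV: "U \<in> components (- contour_set R g)" "V \<in> components (- contour_set R g)"
    "{e + of_nat n | e n. e \<in> E} \<subseteq> U" "uminus ` {e + of_nat n | e n. e \<in> E} \<subseteq> V"
    using sep unfolding separates_def by blast
  have U: "e + of_nat n \<in> U" if "e \<in> E" for e n using UV(3) that by blast
  have V: "- (e + of_nat n) \<in> V" if "e \<in> E" for e n using UV(4) that by blast
  have cU: "U \<inter> contour_set R g = {}" "V \<inter> contour_set R g = {}"
    using in_components_subset[OF UV(1)] in_components_subset[OF UV(2)] by blast+
  show *: "contour_set R g \<subseteq> pole_free E 0"
  proof
    fix x assume x: "x \<in> contour_set R g"
    have "e + x \<notin> \<int>\<^sub>\<le>\<^sub>0 \<and> e - x \<notin> \<int>\<^sub>\<le>\<^sub>0" if e: "e \<in> E" for e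
    proof (intro conjI notI)
      assume "e + x \<in> \<int>\<^sub>\<le>\<^sub>0"
      then obtain n where "e + x = - of_nat n" by (rule nonpos_Ints_cases')
      then have "x = - (e + of_nat n)" by algebra
      then show False using V[OF e] cU x by blast
    next
      assume "e - x \<in> \<int>\<^sub>\<le>\<^sub>0"
      then obtain n where "e - x = - of_nat n" by (rule nonpos_Ints_cases')
      then have "x = e + of_nat n" by (simp add: algebra_simps)
      then show False using U[OF e] cU x by blast
    qed
    then show "x \<in> pole_free E 0" by (simp add: pole_free_def)
  qed
  show "(+) 1 ` contour_set R g \<subseteq> pole_free E 1"
  proof safe
    fix x assume "x \<in> contour_set R g"
    then have "x \<in> pole_free E 0" using * by blast
    then show "1 + x \<in> pole_free E 1"
      using not_nonpos_Int_plus_one[of "e + x" for e] by (force simp: pole_free_def algebra_simps)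
  qed
  assume "w \<notin> pole_free E 1"
  then obtain e where e: "e \<in> E" "e + w \<in> \<int>\<^sub>\<le>\<^sub>0 \<or> e + 1 - w \<in> \<int>\<^sub>\<le>\<^sub>0" by (auto simp: pole_free_def)
  from e(2) show "\<exists>X\<in>components (- contour_set R g). w \<in> X \<and> w - 1 \<in> X"
  proof
    assume "e + w \<in> \<int>\<^sub>\<le>\<^sub>0"
    then obtain n where "e + w = - of_nat n" by (rule nonpos_Ints_cases')
    then have w: "w = - (e + of_nat n)" by algebra
    then have "w - 1 = - (e + of_nat (Suc n))" by simp
    with w show ?thesis using V[OF e(1)] UV(2) by metis
  next
    assume "e + 1 - w \<in> \<int>\<^sub>\<le>\<^sub>0"
    then obtain n where "e + 1 - w = - of_nat n" by (rule nonpos_Ints_cases')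
    then have "w = e + of_nat (Suc n)" "w - 1 = e + of_nat n" by (auto simp: algebra_simps)
    then show ?thesis using U[OF e(1)] UV(1) by metis
  qed
qed

lemma contour_subset_pole_free_1: "contour_set R g \<subseteq> pole_free E 1"
proof
  fix x assume "x \<in> contour_set R g"
  then have "x \<in> pole_free E 0" using contour_pole_free by blast
  then show "x \<in> pole_free E 1"
    using not_nonpos_Int_plus_one[of "e - x" for e] by (force simp: pole_free_def algebra_simps)
qed

lemma trunc_integrable:
  assumes "F holomorphic_on pole_free E s" "contour_set R g \<subseteq> pole_free E s" "S \<ge> R"
  shows "F contour_integrable_on trunc S"
  using contour_integrable_holomorphic_simple[OF assms(1) open_pole_free[OF fin_E] valid_trunc]
    path_image_trunc_subset[OF assms(3)] assms(2) by blast

lemma odd_integral_zero: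
  assumes "G holomorphic_on pole_free E 0" "\<And>z. G (- z) = - G z" "S \<ge> R"
  shows "contour_integral (trunc S) G = 0"
proof -
  have "contour_integral (trunc S) G = contour_integral (trunc S) (\<lambda>z. G (- z))"
    by (rule contour_integral_trunc_uminus[OF open_pole_free[OF fin_E] assms(1) contour_pole_free assms(3), symmetric])
  also have "\<dots> = - contour_integral (trunc S) G"
    unfolding assms(2) by (intro contour_integral_neg trunc_integrable[OF assms(1) contour_pole_free assms(3)])
  finally show ?thesis by simp
qed

text \<open>The reflection rule reads H(z + 1) = -H(-z), so on the symmetric contour the integral of
  H(z) - H(z+1) is twice that of H, while the shift makes it tend to 0. Only a limit results,
  because of the horizontal pieces.\<close>

lemma reflected_integral_limit:
  assumes H: "H holomorphic_on pole_free E 1" "\<And>z. H (1 - z) = - H z"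
    and decay: "strip_decay q H" "q > 1"
  shows "((\<lambda>S. contour_integral (trunc S) H) \<longlongrightarrow> 0) at_top"
proof -
  obtain C y where C: "0 \<le> C" "\<And>x. \<bar>Re x\<bar> \<le> 2 \<Longrightarrow> y \<le> \<bar>Im x\<bar> \<Longrightarrow> norm (H x) \<le> C * exp (- \<bar>Im x\<bar>)"
    using strip_decay_bound[OF decay] by metis
  obtain L where L: "\<And>z s. Im s = 0 \<Longrightarrow> \<bar>Im z\<bar> \<ge> L \<Longrightarrow> z \<in> pole_free E s"
    using pole_free_high[OF fin_E] by blast
  have lim: "((\<lambda>S. contour_integral (trunc S) (\<lambda>z. H z - H (z + 1))) \<longlongrightarrow> 0) at_top"
    by (rule shifted_contour_limit[OF open_pole_free[OF fin_E] H(1) contour_subset_pole_free_1 translate_pole_free _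
          same_side finite_not_pole_free[OF fin_E] C(1), where L = "max L y"])
      (use L C in auto)
  have eq: "contour_integral (trunc S) (\<lambda>z. H z - H (z + 1)) = 2 * contour_integral (trunc S) H" if S: "S \<ge> R" for S
  proof -
    have int: "H contour_integrable_on trunc S"
      by (rule trunc_integrable[OF H(1) contour_subset_pole_free_1 S])
    have "(\<lambda>z. z + 1) holomorphic_on pole_free E 0" by (intro holomorphic_intros)
    moreover have "(\<lambda>z. z + 1) ` pole_free E 0 \<subseteq> pole_free E 1"
      using not_nonpos_Int_plus_one[of "e + x" for e x] by (force simp: pole_free_def algebra_simps)
    ultimately have "H \<circ> (\<lambda>z. z + 1) holomorphic_on pole_free E 0"
      by (rule holomorphic_on_compose_gen[OF _ H(1)])
    then have int': "(\<lambda>z. H (z + 1)) contour_integrable_on trunc S"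
      using trunc_integrable[OF _ contour_pole_free S] by (simp add: o_def)
    have refl: "H (z + 1) = - H (- z)" for z using H(2)[of "- z"] by (simp add: add.commute)
    have "contour_integral (trunc S) (\<lambda>z. H z - H (z + 1)) =
        contour_integral (trunc S) H - contour_integral (trunc S) (\<lambda>z. H (z + 1))"
      by (rule contour_integral_diff[OF int int'])
    also have "contour_integral (trunc S) (\<lambda>z. H (z + 1)) = - contour_integral (trunc S) (\<lambda>z. H (- z))"
      unfolding refl by (rule contour_integral_neg)
    also have "contour_integral (trunc S) (\<lambda>z. H (- z)) = contour_integral (trunc S) H"
      by (rule contour_integral_trunc_uminus[OF open_pole_free[OF fin_E] H(1) contour_subset_pole_free_1 S])
    finally show ?thesis by simp
  qed
  have "((\<lambda>S. 2 * contour_integral (trunc S) H) \<longlongrightarrow> 0) at_top"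
    by (rule Lim_transform_eventually[OF lim]) (rule eventually_mono[OF eventually_ge_at_top[of R] eq])
  then have "((\<lambda>S. (1/2) * (2 * contour_integral (trunc S) H)) \<longlongrightarrow> 0) at_top"
    by (rule tendsto_mult_right_zero)
  then show ?thesis by simp
qed

end

section \<open>Orthogonality of eigenpolynomials\<close>

lemma wilson_form_eq_0:
  assumes adm: "admissible_contour t0 u0 t1 u1 R g"
    and f: "Y t0 u0 t1 u1 f = smult \<nu> f" and h: "Y t0 u0 t1 u1 h = smult \<mu> h" and ne: "\<nu> \<noteq> \<mu>"
  shows "wilson_form t0 u0 t1 u1 R g f h = 0"
proof -
  define a b c d where "a = par_a t1 u1" and "b = par_b t1 u1" and "c = par_c t0 u0" and "d = par_d t0 u0"
  note abcd = a_def b_def c_def d_def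
  interpret wilson_contour R g "{a, b, c, d}"
    using adm unfolding admissible_contour_def Let_def abcd[symmetric]
    by unfold_locales auto
  let ?E = "{a, b, c, d}"
  define sine where "sine x = sin (2 * of_real pi * x)" for x :: complex
  define F where "F x = poly f x * poly h x * weight t0 u0 t1 u1 x" for x
  define G where "G x = Gamma (a + 1 + x) * Gamma (a + 1 - x) * (Gamma (b + 1 + x) * Gamma (b + 1 - x)) *
    (Gamma (c + x) * Gamma (c - x)) * (Gamma (d + x) * Gamma (d - x)) * sine x * poly (Q1 f h) x" for x
  define H where "H x = Gamma (a + x) * Gamma (a + 1 - x) * (Gamma (b + x) * Gamma (b + 1 - x)) *
    (Gamma (c + x) * Gamma (c + 1 - x)) * (Gamma (d + x) * Gamma (d + 1 - x)) * sine x * poly (Q0 f h) x" for x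
  \<comment> \<open>The constant 1/pi is written as a polynomial so that the decay and holomorphy
    rules apply factor by factor.\<close>
  have F_eq: "F = (\<lambda>x. poly f x * poly h x * (Gamma (a + x) * Gamma (a + 1 - x) * Gamma (b + x) * Gamma (b + 1 - x) *
      (Gamma (c + x) * Gamma (c - x)) * (Gamma (d + x) * Gamma (d - x)) * (sine x * poly [:1 / of_real pi:] x)))"
    by (simp add: F_def weight_eq[OF abcd] sine_def fun_eq_iff)

  have sine_hol: "sine holomorphic_on A" for A
    unfolding sine_def by (intro holomorphic_intros)
  have hol0: "(\<lambda>x. Gamma (e + x)) holomorphic_on pole_free ?E 0" "(\<lambda>x. Gamma (e - x)) holomorphic_on pole_free ?E 0"
    "(\<lambda>x. Gamma (e + 1 - x)) holomorphic_on pole_free ?E 0" "(\<lambda>x. Gamma (e + 1 + x)) holomorphic_on pole_free ?E 0"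
    if "e \<in> ?E" for e
    using Gamma_holomorphic_pole_free[OF that, of 0] by simp_all
  have hol1: "(\<lambda>x. Gamma (e + x)) holomorphic_on pole_free ?E 1" "(\<lambda>x. Gamma (e + 1 - x)) holomorphic_on pole_free ?E 1"
    if "e \<in> ?E" for e
    using Gamma_holomorphic_pole_free[OF that, of 1] by simp_all
  have holF: "F holomorphic_on pole_free ?E 0"
    unfolding F_eq by (intro holomorphic_on_mult hol0 sine_hol holomorphic_intros) auto
  have holG: "G holomorphic_on pole_free ?E 0"
    unfolding G_def by (intro holomorphic_on_mult hol0 sine_hol holomorphic_intros) auto
  have holH: "H holomorphic_on pole_free ?E 1"
    unfolding H_def by (intro holomorphic_on_mult hol1 sine_hol holomorphic_intros) auto

  have oddG: "G (- z) = - G z" for z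
    by (simp add: G_def sine_def poly_Q1_reflect mult_ac)
  have oddH: "H (1 - z) = - H z" for z
  proof -
    have sine: "sine (1 - z) = - sine z"
      by (simp add: sine_def right_diff_distrib sin_diff)
    have shift: "e + (1 - z) = e + 1 - z" "e + 1 - (1 - z) = e + z" for e :: complex by simp_all
    show ?thesis unfolding H_def poly_Q0_reflect sine shift by (simp add: mult_ac)
  qed
  have decay_sine: "strip_decay (- 2 * pi) sine"
    using strip_decay_sin by (simp add: sine_def[abs_def])
  \<comment> \<open>Eight Gamma factors give 4 pi, the sine takes 2 pi away, and the polynomial
    costs nothing.\<close>
  have "strip_decay (pi/2 + pi/2 + (pi/2 + pi/2) + (pi/2 + pi/2) + (pi/2 + pi/2) + - 2 * pi + 0) H"
    unfolding H_def
    by (intro strip_decay_mult strip_decay_Gamma_plus strip_decay_Gamma_minus decay_sine strip_decay_poly)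
  then have decayH: "strip_decay (2 * pi) H" by (simp add: algebra_simps)
  have "strip_decay (0 + 0 + (pi/2 + pi/2 + pi/2 + pi/2 + (pi/2 + pi/2) + (pi/2 + pi/2) + (- 2 * pi + 0))) F"
    unfolding F_eq
    by (intro strip_decay_mult strip_decay_Gamma_plus strip_decay_Gamma_minus decay_sine strip_decay_poly)
  then have decayF: "strip_decay (2 * pi) F" by (simp add: algebra_simps)
  have pi1: "2 * pi > 1" using pi_ge_two by linarith

  have key: "(\<nu> - \<mu>) * F x = (G x + H x) / of_real pi" if "x \<in> contour_set R g" for x
  proof -
    \<comment> \<open>Needed for the functional equation: at a pole Gamma is 0 by convention, and
      Gamma(z + 1) = z Gamma(z) fails at z = 0.\<close>
    have x: "x \<in> pole_free ?E 0" using contour_pole_free that by blast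
    have Gam: "Gamma (e + 1 + x) = (e + x) * Gamma (e + x)" "Gamma (e + 1 - x) = (e - x) * Gamma (e - x)"
      if "e \<in> ?E" for e
      using x that Gamma_plus1[of "e + x"] Gamma_plus1[of "e - x"]
      by (auto simp: pole_free_def algebra_simps)
    have w: "weight t0 u0 t1 u1 x * of_real pi =
        Gamma (a + x) * Gamma (a + 1 - x) * Gamma (b + x) * Gamma (b + 1 - x) *
          (Gamma (c + x) * Gamma (c - x)) * (Gamma (d + x) * Gamma (d - x)) * sine x"
      unfolding weight_eq[OF abcd] sine_def by simp
    have ga: "Gamma (a + 1 + x) = (a + x) * Gamma (a + x)" by (rule Gam) simp
    have gb: "Gamma (b + 1 + x) = (b + x) * Gamma (b + x)" by (rule Gam) simp
    have gc: "Gamma (c + 1 - x) = (c - x) * Gamma (c - x)" by (rule Gam) simp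
    have gd: "Gamma (d + 1 - x) = (d - x) * Gamma (d - x)" by (rule Gam) simp
    have Gx: "G x = ((a + x) * (b + x) * poly (Q1 f h) x) * (weight t0 u0 t1 u1 x * of_real pi)"
      unfolding w G_def ga gb by (simp only: mult_ac)
    have Hx: "H x = ((c - x) * (d - x) * poly (Q0 f h) x) * (weight t0 u0 t1 u1 x * of_real pi)"
      unfolding w H_def gc gd by (simp only: mult_ac)
    have "smult (\<nu> - \<mu>) (f * h) = [:a, 1:] * [:b, 1:] * Q1 f h + [:c, -1:] * [:d, -1:] * Q0 f h"
      using Y_commutator[of t0 u0 t1 u1 f h] unfolding f h abcd[symmetric]
      by (simp add: smult_diff_left)
    from arg_cong[OF this, of "\<lambda>p. poly p x"] have "(\<nu> - \<mu>) * (poly f x * poly h x) =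
        (a + x) * (b + x) * poly (Q1 f h) x + (c - x) * (d - x) * poly (Q0 f h) x"
      by (simp only: poly_add poly_smult poly_mult poly_pCons poly_0 mult_zero_right add_0_right
          mult_1_right mult_minus_right add_uminus_conv_diff)
    then have "(\<nu> - \<mu>) * F x = ((a + x) * (b + x) * poly (Q1 f h) x + (c - x) * (d - x) * poly (Q0 f h) x) * weight t0 u0 t1 u1 x"
      by (simp add: F_def mult.assoc[symmetric])
    also have "\<dots> = (G x + H x) / of_real pi"
      unfolding Gx Hx distrib_right[symmetric] by simp
    finally show ?thesis .
  qed

  obtain C y where C: "\<And>x. \<bar>Re x\<bar> \<le> 2 \<Longrightarrow> y \<le> \<bar>Im x\<bar> \<Longrightarrow> norm (F x) \<le> C * exp (- \<bar>Im x\<bar>)"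
    using strip_decay_bound[OF decayF pi1] by metis
  have limF: "((\<lambda>S. contour_integral (trunc S) F) \<longlongrightarrow> full_contour_integral R g F) at_top"
  proof (rule full_contour_integral_limit)
    show "continuous_on (contour_set R g) F"
      using holomorphic_on_imp_continuous_on[OF holF] contour_pole_free by (rule continuous_on_subset)
    show "F contour_integrable_on g"
      using contour_integrable_holomorphic_simple[OF holF open_pole_free valid] contour_pole_free
      by (auto simp: contour_set_def)
    show "norm (F (\<i> * of_real t)) \<le> C * exp (- \<bar>t\<bar>)" if "\<bar>t\<bar> \<ge> y" for t
      using C[of "\<i> * of_real t"] that by simp
  qed
  \<comment> \<open>G contributes exactly 0 for every S \<ge> R, H only in the limit.\<close>
  have "((\<lambda>S. (contour_integral (trunc S) G + contour_integral (trunc S) H) / of_real pi) \<longlongrightarrow> (0 + 0) / of_real pi) at_top"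
  proof (intro tendsto_intros)
    show "((\<lambda>S. contour_integral (trunc S) G) \<longlongrightarrow> 0) at_top"
      by (rule tendsto_eventually) (rule eventually_mono[OF eventually_ge_at_top[of R] odd_integral_zero[OF holG oddG]])
    show "((\<lambda>S. contour_integral (trunc S) H) \<longlongrightarrow> 0) at_top"
      by (rule reflected_integral_limit[OF holH oddH decayH pi1])
  qed auto
  note lim0 = this
  have eq: "(contour_integral (trunc S) G + contour_integral (trunc S) H) / of_real pi =
      (\<nu> - \<mu>) * contour_integral (trunc S) F" if S: "S \<ge> R" for S
  proof -
    have iF: "F contour_integrable_on trunc S" and iG: "G contour_integrable_on trunc S" and iH: "H contour_integrable_on trunc S"
      using trunc_integrable[OF holF contour_pole_free S] trunc_integrable[OF holG contour_pole_free S]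
        trunc_integrable[OF holH contour_subset_pole_free_1 S] by auto
    have "(\<nu> - \<mu>) * contour_integral (trunc S) F = contour_integral (trunc S) (\<lambda>x. (\<nu> - \<mu>) * F x)"
      by (rule contour_integral_lmul[OF iF, symmetric])
    also have "\<dots> = contour_integral (trunc S) (\<lambda>x. (G x + H x) / of_real pi)"
    proof (rule contour_integral_eq)
      fix x assume "x \<in> path_image (trunc S)"
      then show "(\<nu> - \<mu>) * F x = (G x + H x) / of_real pi"
        using path_image_trunc_subset[OF S] by (intro key) blast
    qed
    also have "\<dots> = (contour_integral (trunc S) G + contour_integral (trunc S) H) / of_real pi"
      by (simp add: contour_integral_div contour_integral_add contour_integrable_add iG iH)
    finally show ?thesis by simp
  qed
  have "((\<lambda>S. (\<nu> - \<mu>) * contour_integral (trunc S) F) \<longlongrightarrow> (0 + 0) / of_real pi) at_top"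
    by (rule Lim_transform_eventually[OF lim0 eventually_mono[OF eventually_ge_at_top[of R] eq]])
  moreover have "((\<lambda>S. (\<nu> - \<mu>) * contour_integral (trunc S) F) \<longlongrightarrow> (\<nu> - \<mu>) * full_contour_integral R g F) at_top"
    by (intro tendsto_intros limF)
  ultimately have "(\<nu> - \<mu>) * full_contour_integral R g F = (0 + 0) / of_real pi"
    by (intro tendsto_unique[OF trivial_limit_at_top_linorder])
  then have "full_contour_integral R g F = 0" using ne by simp
  then show ?thesis unfolding wilson_form_def F_def[abs_def] by (simp only: mult_zero_right)
qed

theorem theorem3p2:
  fixes t0 u0 t1 u1 :: complex and R :: real and g :: "real \<Rightarrow> complex"
  assumes "generic t0 u0 t1 u1"
    and "admissible_contour t0 u0 t1 u1 R g"
  shows "\<not> module.dependent smult (range (wilson_poly t0 u0 t1 u1)) \<and>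
    module.span smult (range (wilson_poly t0 u0 t1 u1)) = UNIV \<and>
    (\<forall>m n. m \<noteq> n \<longrightarrow>
      wilson_form t0 u0 t1 u1 R g (wilson_poly t0 u0 t1 u1 m) (wilson_poly t0 u0 t1 u1 n) = 0)"
proof (intro conjI allI impI)
  note p = wilson_poly_eigen[OF assms(1)]
  have nz: "wilson_poly t0 u0 t1 u1 m \<noteq> 0" for m
    using p(2)[of m] by auto
  show "\<not> module.dependent smult (range (wilson_poly t0 u0 t1 u1))"
    by (rule graded_independent[OF vector_space_smult p(1) nz])
  show "module.span smult (range (wilson_poly t0 u0 t1 u1)) = UNIV"
    by (rule graded_span[OF vector_space_smult p(1) nz])
  fix m n :: nat
  assume "m \<noteq> n"
  then have "eigval t0 t1 m \<noteq> eigval t0 t1 n"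
    using eigval_inject[OF assms(1), of m n] by blast
  then show "wilson_form t0 u0 t1 u1 R g (wilson_poly t0 u0 t1 u1 m) (wilson_poly t0 u0 t1 u1 n) = 0"
    by (rule wilson_form_eq_0[OF assms(2) p(3) p(3)])
qed

end
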